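(* Let $\tau>0$, and suppose there is $d>0$ with $d^\pi_\rho(s)\ge d$ for all $s\in\mathcal S$ and all $\pi\in\Pi$. Let $\overline\pi\in\Pi$ and $\boldsymbol\xi\in\mathbb R^n$, $\boldsymbol\xi>0$ entrywise, satisfy $U^{\overline\pi}_{\mathbf g}(\rho)-\mathbf b\ge\boldsymbol\xi$, and let $\Lambda:=\{\boldsymbol\lambda\in\mathbb R^n: 0\le\lambda_i\le (V_\tau^\star-V_\tau^{\overline\pi}(\rho))/\xi_i \text{ for all } i\in[n]\}$. Then the dual function $D$ satisfies: 1. $D$ is differentiable and $$\nabla D(\boldsymbol\lambda)=U_{\mathbf g}^{\pi_{\boldsymbol\lambda}}(\rho)-\mathbf b=\big(U_{g_1}^{\pi_{\boldsymbol\lambda}}(\rho)-b_1,\dots,U_{g_n}^{\pi_{\boldsymbol\lambda}}(\rho)-b_n\big).$$ 2. $D$ is $\ell$-smooth on $\Lambda$, i.e. $\|\nabla D(\boldsymbol\lambda_1)-\nabla D(\boldsymbol\lambda_2)\|_2\le \ell\|\boldsymbol\lambda_1-\boldsymbol\lambda_2\|_2$ for all $\boldsymbol\lambda_1,\boldsymbol\lambda_2\in\Lambda$, where $$\ell=\frac{2\ln 2\,\big(n|\mathcal A|+(1-\gamma)^2\sqrt{n|\mathcal A|}\big)}{\tau(1-\gamma)^3 d}.$$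
   Context: Constrained MDP: finite state space $\mathcal S$, finite action space $\mathcal A$, transition kernel $P(\cdot|s,a)\in\Delta(\mathcal S)$, reward $r:\mathcal S\times\mathcal A\to[0,1]$, utilities $\mathbf g=(g_1,\dots,g_n):\mathcal S\times\mathcal A\to[0,1]^n$, threshold $\mathbf b\in[0,1/(1-\gamma)]^n$, discount $\gamma\in[0,1)$, initial distribution $\rho\in\Delta(\mathcal S)$. A policy is a map $\pi:\mathcal S\to\Delta(\mathcal A)$, viewed as a vector in $\mathbb R^{|\mathcal S||\mathcal A|}$; trajectories satisfy $s_0\sim\rho$, $a_t\sim\pi(\cdot|s_t)$, $s_{t+1}\sim P(\cdot|s_t,a_t)$. $\Pi$ is the class of soft-max policies $\pi_\theta(a|s)=\exp(\theta(s,a))/\sum_{a'}\exp(\theta(s,a'))$, $\theta\in\mathbb R^{|\mathcal S||\mathcal A|}$. $V^\pi(\rho)=\mathbb E[\sum_{t\ge0}\gamma^t r(s_t,a_t)]$, $U^\pi_{g_i}(\rho)=\mathbb E[\sum_{t\ge0}\gamma^t g_i(s_t,a_t)]$, $U^\pi_{\mathbf g}(\rho)=(U^\pi_{g_1}(\rho),\dots,U^\pi_{g_n}(\rho))$, $\mathcal H(\rho,\pi)=\mathbb E[\sum_{t\ge0}-\gamma^t\log\pi(a_t|s_t)]$ (natural log), and $V_\tau^\pi(\rho)=V^\pi(\rho)+\tau\mathcal H(\rho,\pi)$. Discounted state visitation distribution: $d^\pi_\rho(s)=(1-\gamma)\sum_{t\ge0}\gamma^t\Pr(s_t=s\mid\pi,s_0\sim\rho)$.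 Primal problem: $\max_{\pi\in\Pi}V_\tau^\pi(\rho)$ subject to $U^\pi_{\mathbf g}(\rho)\ge\mathbf b$ (entrywise), with an optimal policy $\pi_\tau^\star$ and optimal value $V_\tau^\star=V_\tau^{\pi_\tau^\star}(\rho)$. Lagrangian $L(\pi,\boldsymbol\lambda)=V_\tau^\pi(\rho)+\boldsymbol\lambda^\top(U^\pi_{\mathbf g}(\rho)-\mathbf b)$, $\boldsymbol\lambda\in\mathbb R^n$; dual function $D(\boldsymbol\lambda)=\max_{\pi\in\Pi}L(\pi,\boldsymbol\lambda)$; $\pi_{\boldsymbol\lambda}\in\arg\max_{\pi\in\Pi}L(\pi,\boldsymbol\lambda)$. *)

theory Defs
  imports "HOL-Probability.Probability"
begin

text \<open>
  The state space is a finite type \<open>'s\<close>, the action space a finite type \<open>'a\<close>, and the \<open>n\<close>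
  constraints are indexed by a finite type \<open>'n\<close>, so that \<open>n = CARD('n)\<close> and multipliers live in
  \<open>real ^ 'n\<close> with its Euclidean norm.
\<close>

type_synonym ('s, 'a) policy = "'s \<Rightarrow> 'a pmf"

definition softmax_policies :: "('s::finite, 'a::finite) policy set" where
  "softmax_policies =
     {\<pi>. \<exists>\<theta>::'s \<Rightarrow> 'a \<Rightarrow> real. \<forall>s a. pmf (\<pi> s) a = exp (\<theta> s a) / (\<Sum>a'\<in>UNIV. exp (\<theta> s a'))}"

definition step_kernel ::
    "('s \<Rightarrow> 'a \<Rightarrow> 's pmf) \<Rightarrow> 's pmf \<Rightarrow> ('s, 'a) policy \<Rightarrow> nat \<Rightarrow> (nat \<Rightarrow> 's \<times> 'a) \<Rightarrow> ('s \<times> 'a) measure"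
  where
  "step_kernel P \<rho> \<pi> t \<omega> = measure_pmf
     (bind_pmf (if t = 0 then \<rho> else P (fst (\<omega> (t - 1))) (snd (\<omega> (t - 1))))
        (\<lambda>s. map_pmf (Pair s) (\<pi> s)))"

text \<open>
  The law of the whole trajectory \<open>\<omega> t = (s\<^sub>t, a\<^sub>t)\<close>, given by the Ionescu-Tulcea theorem;
  \<open>step_kernel P \<rho> \<pi> t\<close> is the law of \<open>(s\<^sub>t, a\<^sub>t)\<close> given the past, and the lemma
  \<open>emeasure_trajectory_cylinder\<close> below computes the finite-dimensional distributions.
\<close>

definition trajectory ::
    "('s \<Rightarrow> 'a \<Rightarrow> 's pmf) \<Rightarrow> 's pmf \<Rightarrow> ('s, 'a) policy \<Rightarrow> (nat \<Rightarrow> 's \<times> 'a) measure" where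
  "trajectory P \<rho> \<pi> =
     projective_family.lim UNIV
       (Ionescu_Tulcea.CI (step_kernel P \<rho> \<pi>) (\<lambda>_. count_space UNIV)) (\<lambda>_. count_space UNIV)"

lemma Ionescu_Tulcea_step_kernel:
  "Ionescu_Tulcea (step_kernel P \<rho> \<pi>) (\<lambda>_. count_space UNIV)"
proof (rule Ionescu_Tulcea.intro)
  fix i :: nat
  show "step_kernel P \<rho> \<pi> i \<in>
      measurable (PiM {0..<i} (\<lambda>_. count_space UNIV)) (subprob_algebra (count_space UNIV))"
  proof (cases "i = 0")
    case True
    then have "step_kernel P \<rho> \<pi> i = (\<lambda>_. step_kernel P \<rho> \<pi> 0 undefined)"
      by (simp add: step_kernel_def fun_eq_iff)
    then show ?thesis
      by (auto simp: step_kernel_def measure_pmf_in_subprob_algebra)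
  next
    case False
    have "step_kernel P \<rho> \<pi> i = (\<lambda>\<omega>. step_kernel P \<rho> \<pi> i (\<lambda>_. \<omega> (i - 1)))"
      by (auto simp: step_kernel_def fun_eq_iff)
    moreover have "(\<lambda>\<omega>. step_kernel P \<rho> \<pi> i (\<lambda>_. \<omega> (i - 1))) \<in>
      measurable (PiM {0..<i} (\<lambda>_. count_space UNIV)) (subprob_algebra (count_space UNIV))"
      by (rule measurable_compose[OF measurable_component_singleton])
        (use False in \<open>auto simp: step_kernel_def measure_pmf_in_subprob_algebra\<close>)
    ultimately show ?thesis by simp
  qed
next
  show "prob_space (step_kernel P \<rho> \<pi> i x)" for i x
    unfolding step_kernel_def by (rule measure_pmf.prob_space_axioms)
qed

lemma sets_trajectory:
  "sets (trajectory P \<rho> \<pi>) = sets (PiM UNIV (\<lambda>_. count_space UNIV))"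
proof -
  interpret Ionescu_Tulcea "step_kernel P \<rho> \<pi>" "\<lambda>_. count_space UNIV"
    by (rule Ionescu_Tulcea_step_kernel)
  show ?thesis unfolding trajectory_def by (rule PF.sets_lim)
qed

lemma pmf_step:
  "pmf (bind_pmf p (\<lambda>s. map_pmf (Pair s) (\<pi> s))) x = pmf p (fst x) * pmf (\<pi> (fst x)) (snd x)"
proof -
  have eq: "pmf (map_pmf (Pair s) (\<pi> s)) x = pmf (\<pi> (fst x)) (snd x) * indicator {fst x} s" for s
  proof (cases "s = fst x")
    case True
    then show ?thesis
      using pmf_map_inj'[of "Pair s" "\<pi> s" "snd x"] by (simp add: inj_on_def)
  next
    case False
    then have "x \<notin> set_pmf (map_pmf (Pair s) (\<pi> s))" by auto
    then have "pmf (map_pmf (Pair s) (\<pi> s)) x = 0" by (rule iffD2[OF pmf_eq_0_set_pmf])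
    with False show ?thesis by simp
  qed
  show ?thesis
    by (simp add: pmf_bind eq measure_pmf_single)
qed

lemma emeasure_trajectory_cylinder:
  fixes P :: "'s::finite \<Rightarrow> 'a::finite \<Rightarrow> 's pmf"
  shows "emeasure (trajectory P \<rho> \<pi>) {\<omega>. \<forall>t<T. \<omega> t = x t} =
    (\<Prod>t<T. ennreal (pmf (if t = 0 then \<rho> else P (fst (x (t - 1))) (snd (x (t - 1)))) (fst (x t)) *
       pmf (\<pi> (fst (x t))) (snd (x t))))"
proof -
  let ?M = "\<lambda>_::nat. count_space (UNIV :: ('s \<times> 'a) set)"
  interpret Ionescu_Tulcea "step_kernel P \<rho> \<pi>" ?M
    by (rule Ionescu_Tulcea_step_kernel)
  let ?X = "\<lambda>T. {restrict x {0..<T}}"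
  have X: "?X T \<in> sets (PiM {0..<T} ?M)" for T
  proof -
    have "?X T = PiE {0..<T} (\<lambda>t. {x t})" by (auto simp: PiE_iff extensional_def fun_eq_iff restrict_def)
    also have "\<dots> \<in> sets (PiM {0..<T} ?M)" by (intro sets_PiM_I_finite) auto
    finally show ?thesis .
  qed
  have C: "emeasure (C 0 T (\<lambda>_. undefined)) (?X T) =
    (\<Prod>t<T. ennreal (pmf (if t = 0 then \<rho> else P (fst (x (t - 1))) (snd (x (t - 1)))) (fst (x t)) *
       pmf (\<pi> (fst (x t))) (snd (x t))))" for T
  proof (induction T)
    case 0
    then show ?case by (simp add: PiM_empty)
  next
    case (Suc T)
    let ?p = "pmf (if T = 0 then \<rho> else P (fst (x (T - 1))) (snd (x (T - 1)))) (fst (x T)) *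
       pmf (\<pi> (fst (x T))) (snd (x T))"
    have undef: "(\<lambda>_. undefined) \<in> space (PiM {0..<0} ?M)" by simp
    have sp: "space (C 0 T (\<lambda>_. undefined)) = space (PiM {0..<T} ?M)"
      using space_C[OF undef, of T] by simp
    have st: "sets (C 0 T (\<lambda>_. undefined)) = sets (PiM {0..<T} ?M)"
      using sets_C[OF undef, of T] by simp
    have e: "emeasure (eP T \<omega>) (?X (Suc T)) = ennreal ?p * indicator (?X T) \<omega>"
      if \<omega>: "\<omega> \<in> space (PiM {0..<T} ?M)" for \<omega>
    proof -
      have *: "fun_upd \<omega> T -` ?X (Suc T) \<inter> space (count_space UNIV) =
        (if \<omega> = restrict x {0..<T} then {x T} else {})"
        using \<omega> by (fastforce simp: space_PiM PiE_iff extensional_def fun_eq_iff restrict_def split: if_splits)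
      have "emeasure (eP T \<omega>) (?X (Suc T)) =
         emeasure (step_kernel P \<rho> \<pi> T \<omega>) (if \<omega> = restrict x {0..<T} then {x T} else {})"
        using emeasure_eP[OF \<omega> X[of "Suc T"]] unfolding * .
      also have "\<dots> = ennreal ?p * indicator (?X T) \<omega>"
      proof (cases "\<omega> = restrict x {0..<T}")
        case True
        have "T = 0 \<or> \<omega> (T - 1) = x (T - 1)" using True by auto
        then have "(if T = 0 then \<rho> else P (fst (\<omega> (T - 1))) (snd (\<omega> (T - 1)))) =
            (if T = 0 then \<rho> else P (fst (x (T - 1))) (snd (x (T - 1))))" by auto
        then have "step_kernel P \<rho> \<pi> T \<omega> = measure_pmf
            (bind_pmf (if T = 0 then \<rho> else P (fst (x (T - 1))) (snd (x (T - 1)))) (\<lambda>s. map_pmf (Pair s) (\<pi> s)))"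
          unfolding step_kernel_def by (rule arg_cong)
        then have "emeasure (step_kernel P \<rho> \<pi> T \<omega>) {x T} = ennreal ?p"
          by (simp only: emeasure_pmf_single pmf_step)
        with True show ?thesis by simp
      next
        case False
        then show ?thesis by simp
      qed
      finally show ?thesis .
    qed
    have "emeasure (C 0 (Suc T) (\<lambda>_. undefined)) (?X (Suc T)) =
       (\<integral>\<^sup>+\<omega>. emeasure (eP T \<omega>) (?X (Suc T)) \<partial>C 0 T (\<lambda>_. undefined))"
      using X[of "Suc T"] measurable_eP[of T] st
      by (simp add: emeasure_bind[where N = "PiM {0..<Suc T} ?M"] sp measurable_cong_sets[OF st refl])
    also have "\<dots> = (\<integral>\<^sup>+\<omega>. ennreal ?p * indicator (?X T) \<omega> \<partial>C 0 T (\<lambda>_. undefined))"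
      by (intro nn_integral_cong e) (simp add: sp)
    also have "\<dots> = ennreal ?p * emeasure (C 0 T (\<lambda>_. undefined)) (?X T)"
      using X st by (intro nn_integral_cmult_indicator) auto
    finally show ?case
      unfolding Suc prod.lessThan_Suc by (simp only: mult.commute)
  qed
  have "{\<omega>. \<forall>t<T. \<omega> t = x t} = prod_emb UNIV ?M {0..<T} (?X T)"
    by (auto simp: prod_emb_def fun_eq_iff restrict_def) metis
  then have "emeasure (trajectory P \<rho> \<pi>) {\<omega>. \<forall>t<T. \<omega> t = x t} = emeasure (CI {0..<T}) (?X T)"
    unfolding trajectory_def using lim[OF _ X[of T]] by simp
  also have "\<dots> = emeasure (C 0 T (\<lambda>_. undefined)) (?X T)"
    using emeasure_CI[of "{0..<T}" T, OF _ X] X[of T] sets.sets_into_space[OF X[of T]]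
    by (simp add: prod_emb_id space_PiM)
  finally show ?thesis by (simp add: C)
qed


definition disc_return ::
    "('s \<Rightarrow> 'a \<Rightarrow> 's pmf) \<Rightarrow> real \<Rightarrow> 's pmf \<Rightarrow> ('s \<Rightarrow> 'a \<Rightarrow> real) \<Rightarrow> ('s, 'a) policy \<Rightarrow> real" where
  "disc_return P \<gamma> \<rho> f \<pi> =
     (\<integral>\<omega>. (\<Sum>t. \<gamma> ^ t * f (fst (\<omega> t)) (snd (\<omega> t))) \<partial>trajectory P \<rho> \<pi>)"

definition utility_vec ::
    "('s \<Rightarrow> 'a \<Rightarrow> 's pmf) \<Rightarrow> real \<Rightarrow> 's pmf \<Rightarrow> ('s \<Rightarrow> 'a \<Rightarrow> real ^ 'n::finite) \<Rightarrow> ('s, 'a) policy \<Rightarrow> real ^ 'n"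
  where
  "utility_vec P \<gamma> \<rho> g \<pi> = (\<chi> i. disc_return P \<gamma> \<rho> (\<lambda>s a. g s a $ i) \<pi>)"

definition disc_entropy ::
    "('s \<Rightarrow> 'a \<Rightarrow> 's pmf) \<Rightarrow> real \<Rightarrow> 's pmf \<Rightarrow> ('s, 'a) policy \<Rightarrow> real" where
  "disc_entropy P \<gamma> \<rho> \<pi> =
     (\<integral>\<omega>. (\<Sum>t. - (\<gamma> ^ t) * ln (pmf (\<pi> (fst (\<omega> t))) (snd (\<omega> t)))) \<partial>trajectory P \<rho> \<pi>)"

definition reg_value ::
    "('s \<Rightarrow> 'a \<Rightarrow> 's pmf) \<Rightarrow> real \<Rightarrow> 's pmf \<Rightarrow> ('s \<Rightarrow> 'a \<Rightarrow> real) \<Rightarrow> real \<Rightarrow> ('s, 'a) policy \<Rightarrow> real" where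
  "reg_value P \<gamma> \<rho> r \<tau> \<pi> = disc_return P \<gamma> \<rho> r \<pi> + \<tau> * disc_entropy P \<gamma> \<rho> \<pi>"

definition visitation ::
    "('s \<Rightarrow> 'a \<Rightarrow> 's pmf) \<Rightarrow> real \<Rightarrow> 's pmf \<Rightarrow> ('s, 'a) policy \<Rightarrow> 's \<Rightarrow> real" where
  "visitation P \<gamma> \<rho> \<pi> s =
     (1 - \<gamma>) * (\<Sum>t. \<gamma> ^ t * measure (trajectory P \<rho> \<pi>) {\<omega>. fst (\<omega> t) = s})"

definition primal_feasible ::
    "('s::finite \<Rightarrow> 'a::finite \<Rightarrow> 's pmf) \<Rightarrow> real \<Rightarrow> 's pmf \<Rightarrow> ('s \<Rightarrow> 'a \<Rightarrow> real ^ 'n::finite) \<Rightarrow> real ^ 'n \<Rightarrow>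
     ('s, 'a) policy \<Rightarrow> bool" where
  "primal_feasible P \<gamma> \<rho> g b \<pi> \<longleftrightarrow>
     \<pi> \<in> softmax_policies \<and> (\<forall>i. b $ i \<le> utility_vec P \<gamma> \<rho> g \<pi> $ i)"

definition lagrangian ::
    "('s \<Rightarrow> 'a \<Rightarrow> 's pmf) \<Rightarrow> real \<Rightarrow> 's pmf \<Rightarrow> ('s \<Rightarrow> 'a \<Rightarrow> real) \<Rightarrow> ('s \<Rightarrow> 'a \<Rightarrow> real ^ 'n::finite) \<Rightarrow>
     real ^ 'n \<Rightarrow> real \<Rightarrow> real ^ 'n \<Rightarrow> ('s, 'a) policy \<Rightarrow> real" where
  "lagrangian P \<gamma> \<rho> r g b \<tau> l \<pi> = reg_value P \<gamma> \<rho> r \<tau> \<pi> + l \<bullet> (utility_vec P \<gamma> \<rho> g \<pi> - b)"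

definition lagrangian_maximizer ::
    "('s::finite \<Rightarrow> 'a::finite \<Rightarrow> 's pmf) \<Rightarrow> real \<Rightarrow> 's pmf \<Rightarrow> ('s \<Rightarrow> 'a \<Rightarrow> real) \<Rightarrow>
     ('s \<Rightarrow> 'a \<Rightarrow> real ^ 'n::finite) \<Rightarrow> real ^ 'n \<Rightarrow> real \<Rightarrow> real ^ 'n \<Rightarrow> ('s, 'a) policy \<Rightarrow> bool" where
  "lagrangian_maximizer P \<gamma> \<rho> r g b \<tau> l =
     is_arg_max (lagrangian P \<gamma> \<rho> r g b \<tau> l) (\<lambda>\<pi>. \<pi> \<in> softmax_policies)"

text \<open>
  The supremum below is the maximum over \<open>softmax_policies\<close> whenever a \<open>lagrangian_maximizer\<close>
  exists; on its own, \<open>SUP\<close> would say nothing about attainment.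
\<close>

definition dual_fun ::
    "('s::finite \<Rightarrow> 'a::finite \<Rightarrow> 's pmf) \<Rightarrow> real \<Rightarrow> 's pmf \<Rightarrow> ('s \<Rightarrow> 'a \<Rightarrow> real) \<Rightarrow>
     ('s \<Rightarrow> 'a \<Rightarrow> real ^ 'n::finite) \<Rightarrow> real ^ 'n \<Rightarrow> real \<Rightarrow> real ^ 'n \<Rightarrow> real" where
  "dual_fun P \<gamma> \<rho> r g b \<tau> l = (SUP \<pi>\<in>softmax_policies. lagrangian P \<gamma> \<rho> r g b \<tau> l \<pi>)"

text \<open>Meaningful only at points where \<open>f\<close> is differentiable.\<close>

definition gradient :: "('v::real_inner \<Rightarrow> real) \<Rightarrow> 'v \<Rightarrow> 'v" where
  "gradient f x = (THE v. GDERIV f x :> v)"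

end

theory Submission
  imports Defs
begin

text \<open>
  Write \<open>\<nu>\<^sup>\<pi>\<close> for the unnormalised discounted state occupancy, so that every discounted return is
  linear in \<open>\<nu>\<^sup>\<pi>(s) \<pi>(a|s)\<close>. If \<open>V\<close> is a fixed point of the soft Bellman operator for the reward
  \<open>r + \<lambda> \<bullet> g\<close> and \<open>\<pi>\<^sub>\<lambda>\<close> the corresponding Gibbs policy, the flow equation for \<open>\<nu>\<^sup>\<pi>\<close> telescopes
  \<open>V\<close> and yields the exact gap
  \<open>L(\<pi>\<^sub>\<lambda>, \<lambda>) - L(\<pi>, \<lambda>) = \<tau> \<Sum>\<^sub>s \<nu>\<^sup>\<pi>(s) KL(\<pi>(s) \<parallel> \<pi>\<^sub>\<lambda>(s))\<close>.
  Adding the gaps at \<open>\<lambda>\<close> and \<open>\<lambda>'\<close> turns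
  \<open>(\<lambda> - \<lambda>') \<bullet> (U(\<pi>\<^sub>\<lambda>) - U(\<pi>\<^sub>\<lambda>\<^sub>'))\<close> into \<open>\<tau>\<close> times a symmetrised KL divergence, which by a
  Pinsker-type inequality and an \<open>L\<^sup>1\<close> perturbation bound for occupancies dominates a multiple of
  \<open>\<parallel>U(\<pi>\<^sub>\<lambda>) - U(\<pi>\<^sub>\<lambda>\<^sub>')\<parallel>\<^sup>2\<close>. Hence \<open>\<lambda> \<mapsto> U(\<pi>\<^sub>\<lambda>)\<close> is Lipschitz with constant
  \<open>n |A| / (\<tau> (1 - \<gamma>)\<^sup>3)\<close>, which is at most the required one because \<open>d \<le> 1\<close> and \<open>2 ln 2 \<ge> 1\<close>.
  A Lipschitz selection of subgradients is a gradient.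
\<close>

section \<open>Marginals of the trajectory law and its one-step recursion\<close>

lemma space_trajectory [simp]: "space (trajectory P \<rho> \<pi>) = UNIV"
  using sets_eq_imp_space_eq[OF sets_trajectory[of P \<rho> \<pi>]] by (simp add: space_PiM PiE_def)

lemma prob_space_trajectory:
  fixes P :: "'s::finite \<Rightarrow> 'a::finite \<Rightarrow> 's pmf"
  shows "prob_space (trajectory P \<rho> \<pi>)"
  using emeasure_trajectory_cylinder[of P \<rho> \<pi> 0] by (auto intro: prob_spaceI)

lemma measurable_trajectory_coordinate [measurable]:
  "(\<lambda>\<omega>. \<omega> t) \<in> measurable (trajectory P \<rho> \<pi>) (count_space UNIV)"
  by (subst measurable_cong_sets[OF sets_trajectory refl]) simp

lemma sets_trajectory_coordinate [measurable]:
  "{\<omega>. Q (\<omega> t)} \<in> sets (trajectory P \<rho> \<pi>)"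
proof -
  have "(\<lambda>\<omega>. \<omega> t) -` {x. Q x} \<inter> space (trajectory P \<rho> \<pi>) \<in> sets (trajectory P \<rho> \<pi>)"
    by (rule measurable_sets[OF measurable_trajectory_coordinate]) simp
  then show ?thesis by (simp add: vimage_def)
qed

lemma sets_trajectory_cylinder [measurable]:
  "{\<omega>. \<forall>t<T. \<omega> t = x t} \<in> sets (trajectory P \<rho> \<pi>)" for T :: nat
proof -
  have "{\<omega> \<in> space (trajectory P \<rho> \<pi>). \<forall>t\<in>{..<T}. \<omega> t = x t} \<in> sets (trajectory P \<rho> \<pi>)"
    by (rule sets.sets_Collect_finite_All) (auto intro: sets_trajectory_coordinate)
  then show ?thesis by (simp add: Ball_def)
qed

lemma measure_trajectory_cylinder:
  fixes P :: "'s::finite \<Rightarrow> 'a::finite \<Rightarrow> 's pmf"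
  shows "measure (trajectory P \<rho> \<pi>) {\<omega>. \<forall>t<T. \<omega> t = x t} =
    (\<Prod>t<T. pmf (if t = 0 then \<rho> else P (fst (x (t - 1))) (snd (x (t - 1)))) (fst (x t)) *
       pmf (\<pi> (fst (x t))) (snd (x t)))"
  unfolding measure_def emeasure_trajectory_cylinder
  by (subst prod_ennreal) (auto intro!: prod_nonneg enn2real_ennreal)

text \<open>The product formula covers only events that fix all coordinates from time 0 on. An event
  on the window from \<open>t\<close> to \<open>T - 1\<close> is the disjoint union of such
  cylinders over the finitely many prefixes \<open>z\<close>.\<close>

lemma measure_trajectory_eq_sum:
  fixes P :: "'s::finite \<Rightarrow> 'a::finite \<Rightarrow> 's pmf"
  assumes "t \<le> T"
  shows "measure (trajectory P \<rho> \<pi>) {\<omega>. \<forall>i. t \<le> i \<and> i < T \<longrightarrow> \<omega> i = x i} =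
    (\<Sum>z\<in>PiE {..<t} (\<lambda>_. UNIV). measure (trajectory P \<rho> \<pi>)
       {\<omega>. \<forall>i<T. \<omega> i = (if i < t then z i else x i)})"
proof -
  interpret prob_space "trajectory P \<rho> \<pi>" by (rule prob_space_trajectory)
  let ?C = "\<lambda>z. {\<omega>. \<forall>i<T. \<omega> i = (if i < t then z i else x i)}"
  have eq: "{\<omega>. \<forall>i. t \<le> i \<and> i < T \<longrightarrow> \<omega> i = x i} = (\<Union>z\<in>PiE {..<t} (\<lambda>_. UNIV). ?C z)"
  proof (intro set_eqI iffI)
    fix \<omega> assume "\<omega> \<in> {\<omega>. \<forall>i. t \<le> i \<and> i < T \<longrightarrow> \<omega> i = x i}"
    \<comment> \<open>The prefix belonging to \<open>\<omega>\<close> is its own initial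
      segment.\<close>
    then have "\<omega> \<in> ?C (restrict \<omega> {..<t})" by auto
    then show "\<omega> \<in> (\<Union>z\<in>PiE {..<t} (\<lambda>_. UNIV). ?C z)" by (intro UN_I[of "restrict \<omega> {..<t}"]) simp_all
  qed auto
  have disj: "disjoint_family_on ?C (PiE {..<t} (\<lambda>_. UNIV))"
  proof (unfold disjoint_family_on_def, intro ballI impI)
    fix y z :: "nat \<Rightarrow> 's \<times> 'a"
    assume yz: "y \<in> PiE {..<t} (\<lambda>_. UNIV)" "z \<in> PiE {..<t} (\<lambda>_. UNIV)" "y \<noteq> z"
    then obtain i where "i < t" "y i \<noteq> z i" by (metis PiE_ext lessThan_iff)
    with assms show "?C y \<inter> ?C z = {}" by force
  qed
  show ?thesis
    unfolding eq
    by (rule finite_measure_finite_Union[OF _ image_subsetI[OF sets_trajectory_cylinder] disj])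
      (simp add: finite_PiE)
qed

lemma measure_trajectory_0:
  fixes P :: "'s::finite \<Rightarrow> 'a::finite \<Rightarrow> 's pmf"
  shows "measure (trajectory P \<rho> \<pi>) {\<omega>. \<omega> 0 = (s, a)} = pmf \<rho> s * pmf (\<pi> s) a"
  using measure_trajectory_cylinder[of P \<rho> \<pi> 1 "\<lambda>_. (s, a)"] by simp

text \<open>The Markov property without conditioning: extending a cylinder by one step multiplies
  its weight by a factor that ignores the prefix, so the factor leaves the sum over
  prefixes.\<close>

lemma measure_trajectory_Suc:
  fixes P :: "'s::finite \<Rightarrow> 'a::finite \<Rightarrow> 's pmf"
  shows "measure (trajectory P \<rho> \<pi>) {\<omega>. \<omega> (Suc t) = (s', a')} =
    (\<Sum>s\<in>UNIV. \<Sum>a\<in>UNIV. measure (trajectory P \<rho> \<pi>) {\<omega>. \<omega> t = (s, a)} * pmf (P s a) s') * pmf (\<pi> s') a'"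
proof -
  interpret prob_space "trajectory P \<rho> \<pi>" by (rule prob_space_trajectory)
  let ?m = "measure (trajectory P \<rho> \<pi>)"
  have joint: "?m {\<omega>. \<omega> t = (s, a) \<and> \<omega> (Suc t) = (s', a')} =
      ?m {\<omega>. \<omega> t = (s, a)} * (pmf (P s a) s' * pmf (\<pi> s') a')" for s a
  proof -
    \<comment> \<open>Only the values at \<open>t\<close> and \<open>Suc t\<close> matter; earlier
      coordinates are overwritten by the prefix \<open>z\<close>.\<close>
    define x where "x i = (if i = t then (s, a) else (s', a'))" for i
    let ?c = "\<lambda>T z. ?m {\<omega>. \<forall>i<T. \<omega> i = (if i < t then z i else x i)}"
    have "{\<omega>. \<omega> t = (s, a) \<and> \<omega> (Suc t) = (s', a')} =
        {\<omega>. \<forall>i. t \<le> i \<and> i < Suc (Suc t) \<longrightarrow> \<omega> i = x i}"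
      by (auto simp: less_Suc_eq x_def)
    then have "?m {\<omega>. \<omega> t = (s, a) \<and> \<omega> (Suc t) = (s', a')} =
        (\<Sum>z\<in>PiE {..<t} (\<lambda>_. UNIV). ?c (Suc (Suc t)) z)"
      by (simp only: measure_trajectory_eq_sum le_SucI order_refl)
    \<comment> \<open>The last factor of the product, at index \<open>Suc t\<close>, sees the past
      only through coordinate \<open>t\<close>, which is \<open>(s, a)\<close> for every
      prefix.\<close>
    also have "\<dots> = (\<Sum>z\<in>PiE {..<t} (\<lambda>_. UNIV). ?c (Suc t) z * (pmf (P s a) s' * pmf (\<pi> s') a'))"
      unfolding measure_trajectory_cylinder prod.lessThan_Suc[of _ "Suc t"] by (simp add: x_def)
    also have "\<dots> = ?m {\<omega>. \<forall>i. t \<le> i \<and> i < Suc t \<longrightarrow> \<omega> i = x i} * (pmf (P s a) s' * pmf (\<pi> s') a')"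
      by (simp only: measure_trajectory_eq_sum le_SucI order_refl sum_distrib_right)
    also have "{\<omega>. \<forall>i. t \<le> i \<and> i < Suc t \<longrightarrow> \<omega> i = x i} = {\<omega>. \<omega> t = (s, a)}"
      by (auto simp: less_Suc_eq x_def)
    finally show ?thesis .
  qed
  have "{\<omega>. \<omega> (Suc t) = (s', a')} =
     (\<Union>x\<in>UNIV. {\<omega>. \<omega> t = x \<and> \<omega> (Suc t) = (s', a')})" by auto
  also have "?m \<dots> = (\<Sum>x\<in>UNIV. ?m {\<omega>. \<omega> t = x \<and> \<omega> (Suc t) = (s', a')})"
  proof (rule finite_measure_finite_Union)
    show "(\<lambda>x. {\<omega>. \<omega> t = x \<and> \<omega> (Suc t) = (s', a')}) ` UNIV \<subseteq> events"
      by (auto simp: Collect_conj_eq intro!: sets.Int sets_trajectory_coordinate)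
  qed (auto simp: disjoint_family_on_def)
  also have "\<dots> = (\<Sum>s\<in>UNIV. \<Sum>a\<in>UNIV. ?m {\<omega>. \<omega> t = (s, a) \<and> \<omega> (Suc t) = (s', a')})"
    unfolding sum.cartesian_product by (rule sum.cong) auto
  finally show ?thesis
    by (simp add: joint sum_distrib_left mult_ac)
qed

lemma measure_trajectory_state_eq_sum:
  fixes P :: "'s::finite \<Rightarrow> 'a::finite \<Rightarrow> 's pmf"
  shows "measure (trajectory P \<rho> \<pi>) {\<omega>. fst (\<omega> t) = s} =
    (\<Sum>a\<in>UNIV. measure (trajectory P \<rho> \<pi>) {\<omega>. \<omega> t = (s, a)})"
proof -
  interpret prob_space "trajectory P \<rho> \<pi>" by (rule prob_space_trajectory)
  have "{\<omega>. fst (\<omega> t) = s} = (\<Union>a\<in>UNIV. {\<omega> :: nat \<Rightarrow> 's \<times> 'a. \<omega> t = (s, a)})"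
    by (auto simp: prod_eq_iff)
  then show ?thesis
    by (simp only:) (rule finite_measure_finite_Union,
      auto simp: disjoint_family_on_def intro: sets_trajectory_coordinate)
qed

lemma sum_pmf_UNIV: "(\<Sum>a\<in>UNIV. pmf p (a::'a::finite)) = 1"
  by (rule sum_pmf_eq_1) auto

text \<open>No induction is involved: the formulas at time 0 and at successor times both end in the
  factor \<open>pmf (\<pi> s) a\<close>, and summing over actions removes it.\<close>

lemma measure_trajectory_state_action:
  fixes P :: "'s::finite \<Rightarrow> 'a::finite \<Rightarrow> 's pmf"
  shows "measure (trajectory P \<rho> \<pi>) {\<omega>. \<omega> t = (s, a)} =
    measure (trajectory P \<rho> \<pi>) {\<omega>. fst (\<omega> t) = s} * pmf (\<pi> s) a"
  by (cases t) (simp_all add: measure_trajectory_state_eq_sum measure_trajectory_0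
    measure_trajectory_Suc sum_pmf_UNIV flip: sum_distrib_left)

section \<open>Occupancies and the soft-max class\<close>

definition occupancy ::
    "('s \<Rightarrow> 'a \<Rightarrow> 's pmf) \<Rightarrow> real \<Rightarrow> 's pmf \<Rightarrow> ('s, 'a) policy \<Rightarrow> 's \<Rightarrow> real" where
  "occupancy P \<gamma> \<rho> \<pi> s = (\<Sum>t. \<gamma> ^ t * measure (trajectory P \<rho> \<pi>) {\<omega>. fst (\<omega> t) = s})"

lemma visitation_eq_occupancy: "visitation P \<gamma> \<rho> \<pi> s = (1 - \<gamma>) * occupancy P \<gamma> \<rho> \<pi> s"
  by (simp add: visitation_def occupancy_def)

lemma abs_le_sum_sum_abs:
  fixes f :: "'s::finite \<Rightarrow> 'a::finite \<Rightarrow> real"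
  shows "\<bar>f s a\<bar> \<le> (\<Sum>s\<in>UNIV. \<Sum>a\<in>UNIV. \<bar>f s a\<bar>)"
proof -
  have "\<bar>f s a\<bar> \<le> (\<Sum>a\<in>UNIV. \<bar>f s a\<bar>)" by (rule member_le_sum) auto
  also have "\<dots> \<le> (\<Sum>s\<in>UNIV. \<Sum>a\<in>UNIV. \<bar>f s a\<bar>)"
    by (rule member_le_sum[of s UNIV "\<lambda>s. \<Sum>a\<in>UNIV. \<bar>f s a\<bar>"]) (auto intro: sum_nonneg)
  finally show ?thesis .
qed

text \<open>The logits \<open>\<theta> = ln \<pi>\<close> reproduce a positive policy, the
  normaliser being 1. The policy class is handled through positivity from here on, which keeps the
  logarithms in KL terms meaningful.\<close>

lemma softmax_policies_iff_pos: "\<pi> \<in> softmax_policies \<longleftrightarrow> (\<forall>s a. 0 < pmf (\<pi> s) a)"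
proof
  assume "\<pi> \<in> softmax_policies"
  then show "\<forall>s a. 0 < pmf (\<pi> s) a"
    by (auto simp: softmax_policies_def intro!: divide_pos_pos sum_pos)
next
  assume "\<forall>s a. 0 < pmf (\<pi> s) a"
  then show "\<pi> \<in> softmax_policies"
    unfolding softmax_policies_def by (intro CollectI exI[of _ "\<lambda>s a. ln (pmf (\<pi> s) a)"]) (simp add: sum_pmf_UNIV)
qed

section \<open>A Pinsker-type inequality\<close>

text \<open>The Kullback-Leibler divergence in nats. A real value suffices because it is applied
  with positive second arguments.\<close>

definition pmf_KL :: "'a::finite pmf \<Rightarrow> 'a pmf \<Rightarrow> real" where
  "pmf_KL p q = (\<Sum>a\<in>UNIV. pmf p a * (ln (pmf p a) - ln (pmf q a)))"

text \<open>As a function of \<open>p\<close>, right side minus left side vanishes at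
  \<open>q\<close> and has derivative \<open>ln p - ln q - (p - q)\<close>. Since \<open>ln\<close>
  has slope at least 1 on (0,1], this has the sign of \<open>p - q\<close>, so \<open>q\<close> is a
  minimum. The correction \<open>- p + q\<close> cancels when summed over a distribution.\<close>

lemma square_diff_le_KL_term:
  fixes p q :: real
  assumes "0 < p" "p \<le> 1" "0 < q" "q \<le> 1"
  shows "(p - q)\<^sup>2 / 2 \<le> p * (ln p - ln q) - p + q"
proof -
  define f where "f x = x * (ln x - ln q) - x + q - (x - q)\<^sup>2 / 2" for x
  have deriv: "DERIV f x :> ln x - ln q - (x - q)" if "0 < x" for x
    unfolding f_def using that by (auto intro!: derivative_eq_intros simp: field_simps)
  have ln_diff: "y - x \<le> ln y - ln x" if "0 < x" "x \<le> y" "y \<le> 1" for x y :: real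
  proof -
    have "ln x - ln y \<le> x / y - 1" using that ln_le_minus_one[of "x / y"] by (simp add: ln_div)
    moreover have "(y - x) * 1 \<le> (y - x) / y" using that by (simp add: le_divide_eq mult_left_le)
    moreover have "(y - x) / y = 1 - x / y" using that by (simp add: diff_divide_distrib)
    ultimately show ?thesis by simp
  qed
  have "f q \<le> f p"
  proof (cases "q \<le> p")
    case True
    then show ?thesis
    proof (rule DERIV_nonneg_imp_nondecreasing)
      fix x assume "q \<le> x" "x \<le> p"
      with assms deriv[of x] ln_diff[of q x] show "\<exists>y. DERIV f x :> y \<and> 0 \<le> y" by fastforce
    qed
  next
    case False
    then have "p \<le> q" by simp
    then show ?thesis
    proof (rule DERIV_nonpos_imp_nonincreasing)
      fix x assume "p \<le> x" "x \<le> q"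
      with assms deriv[of x] ln_diff[of x q] show "\<exists>y. DERIV f x :> y \<and> y \<le> 0" by fastforce
    qed
  qed
  then show ?thesis by (simp add: f_def)
qed

text \<open>The termwise bounds add up to an L2 estimate, and Cauchy-Schwarz turns L2 into L1 at the
  price of \<open>CARD('a)\<close>. This is weaker than Pinsker, but the factor is available in the
  final constant.\<close>

lemma L1_square_le_KL:
  fixes p q :: "'a::finite pmf"
  assumes "\<And>a. 0 < pmf p a" "\<And>a. 0 < pmf q a"
  shows "(\<Sum>a\<in>UNIV. \<bar>pmf p a - pmf q a\<bar>)\<^sup>2 \<le> 2 * real CARD('a) * pmf_KL p q"
proof -
  have "(\<Sum>a\<in>UNIV. (pmf p a - pmf q a)\<^sup>2 / 2) \<le>
      (\<Sum>a\<in>UNIV. pmf p a * (ln (pmf p a) - ln (pmf q a)) - pmf p a + pmf q a)"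
    by (intro sum_mono square_diff_le_KL_term assms pmf_le_1)
  also have "\<dots> = pmf_KL p q"
    by (simp add: pmf_KL_def sum.distrib sum_subtractf sum_pmf_UNIV)
  finally have "(\<Sum>a\<in>UNIV. (pmf p a - pmf q a)\<^sup>2) \<le> 2 * pmf_KL p q"
    by (simp flip: sum_divide_distrib)
  moreover have "(\<Sum>a\<in>UNIV. \<bar>pmf p a - pmf q a\<bar>)\<^sup>2 \<le> (\<Sum>a\<in>UNIV. \<bar>pmf p a - pmf q a\<bar>\<^sup>2) * real CARD('a)"
    using sum_squared_le_sum_of_squares[of "\<lambda>a. \<bar>pmf p a - pmf q a\<bar>" UNIV] by simp
  ultimately have "(\<Sum>a\<in>UNIV. \<bar>pmf p a - pmf q a\<bar>)\<^sup>2 \<le> 2 * pmf_KL p q * real CARD('a)"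
    unfolding power2_abs by (meson mult_right_mono of_nat_0_le_iff order_trans)
  then show ?thesis by (simp add: mult_ac)
qed

lemma pmf_KL_nonneg:
  assumes "\<And>a. 0 < pmf p a" "\<And>a. 0 < pmf q a"
  shows "0 \<le> pmf_KL p q"
proof -
  have "0 \<le> 2 * real CARD('a) * pmf_KL p q"
    by (rule order_trans[OF zero_le_power2 L1_square_le_KL[OF assms]])
  then show ?thesis by (simp add: zero_le_mult_iff)
qed

section \<open>The soft Bellman equation\<close>

text \<open>Existence comes from Brouwer: the soft Bellman operator is continuous and maps a
  sufficiently large cube into itself.\<close>

lemma soft_bellman_fixed_point:
  fixes P :: "'s::finite \<Rightarrow> 'a::finite \<Rightarrow> 's pmf" and R :: "'s \<Rightarrow> 'a \<Rightarrow> real"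
  assumes \<gamma>: "0 \<le> \<gamma>" "\<gamma> < 1" and \<tau>: "0 < \<tau>"
  obtains V where "\<And>s. V s = \<tau> * ln (\<Sum>a\<in>UNIV. exp ((R s a + \<gamma> * (\<Sum>s'\<in>UNIV. pmf (P s a) s' * V s')) / \<tau>))"
proof -
  define B where "B = (\<Sum>s\<in>UNIV. \<Sum>a\<in>UNIV. \<bar>R s a\<bar>)"
  have B: "\<bar>R s a\<bar> \<le> B" for s a
    unfolding B_def by (rule abs_le_sum_sum_abs)
  \<comment> \<open>\<open>M\<close> solves
    \<open>M = \<tau> * ln CARD('a) + B + \<gamma> * M\<close>, the worst case of one application of
    the operator to a vector bounded by \<open>M\<close>.\<close>
  define M where "M = (B + \<tau> * ln (real CARD('a))) / (1 - \<gamma>)"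
  have M: "\<tau> * ln (real CARD('a)) + (B + \<gamma> * M) = M"
    using \<gamma> by (simp add: M_def field_simps)
  have card: "1 \<le> real CARD('a)" by (simp add: Suc_leI)
  have B0: "0 \<le> B" unfolding B_def by (intro sum_nonneg) auto
  have M0: "0 \<le> M"
    unfolding M_def using \<gamma> \<tau> B0 card by (intro divide_nonneg_pos add_nonneg_nonneg mult_nonneg_nonneg) auto
  define Q where "Q v s a = (R s a + \<gamma> * (\<Sum>s'\<in>UNIV. pmf (P s a) s' * v $ s'))" for v :: "real ^ 's" and s a
  define T where "T v = (\<chi> s. \<tau> * ln (\<Sum>a\<in>UNIV. exp (Q v s a / \<tau>)))" for v :: "real ^ 's"
  let ?S = "cbox (\<chi> i. - M) (\<chi> i. M) :: (real ^ 's) set"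
  have "continuous_on ?S T"
    unfolding T_def Q_def
    by (intro continuous_intros) (use \<tau> in \<open>auto simp: sum_nonneg_eq_0_iff\<close>)
  moreover have "T \<in> ?S \<rightarrow> ?S"
  proof
    fix v assume "v \<in> ?S"
    then have v: "\<bar>v $ i\<bar> \<le> M" for i by (auto simp: mem_box_cart abs_le_iff minus_le_iff)
    have "\<bar>Q v s a\<bar> \<le> B + \<gamma> * M" for s a
    proof -
      have "\<bar>\<Sum>s'\<in>UNIV. pmf (P s a) s' * v $ s'\<bar> \<le> (\<Sum>s'\<in>UNIV. pmf (P s a) s' * M)"
        by (rule order_trans[OF sum_abs sum_mono]) (simp add: abs_mult v mult_left_mono)
      then have "\<bar>\<Sum>s'\<in>UNIV. pmf (P s a) s' * v $ s'\<bar> \<le> M"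
        by (simp add: sum_pmf_UNIV flip: sum_distrib_right)
      then have "\<bar>\<gamma> * (\<Sum>s'\<in>UNIV. pmf (P s a) s' * v $ s')\<bar> \<le> \<gamma> * M"
        using \<gamma> by (simp add: abs_mult mult_left_mono)
      with B[of s a] show ?thesis unfolding Q_def by linarith
    qed
    then have "- (B + \<gamma> * M) \<le> Q v s a" "Q v s a \<le> B + \<gamma> * M" for s a
      by (simp_all only: abs_le_iff minus_le_iff)
    then have Q: "exp (- (B + \<gamma> * M) / \<tau>) \<le> exp (Q v s a / \<tau>)" "exp (Q v s a / \<tau>) \<le> exp ((B + \<gamma> * M) / \<tau>)" for s a
      using \<tau> by (simp_all only: exp_le_cancel_iff divide_right_mono less_imp_le)
    have up: "\<tau> * ln (\<Sum>a\<in>UNIV. exp (Q v s a / \<tau>)) \<le> M" for s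
    proof -
      have "ln (\<Sum>a\<in>UNIV. exp (Q v s a / \<tau>)) \<le> ln (real CARD('a) * exp ((B + \<gamma> * M) / \<tau>))"
        using sum_bounded_above[of UNIV "\<lambda>a. exp (Q v s a / \<tau>)", OF Q(2)] by (intro ln_mono) (auto intro: sum_pos)
      also have "\<dots> = ln (real CARD('a)) + (B + \<gamma> * M) / \<tau>" using card by (simp add: ln_mult)
      finally have "\<tau> * ln (\<Sum>a\<in>UNIV. exp (Q v s a / \<tau>)) \<le> \<tau> * (ln (real CARD('a)) + (B + \<gamma> * M) / \<tau>)"
        using \<tau> by simp
      also have "\<dots> = M" using M \<tau> by (simp add: field_simps)
      finally show ?thesis .
    qed
    have lo: "- M \<le> \<tau> * ln (\<Sum>a\<in>UNIV. exp (Q v s a / \<tau>))" for s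
    proof -
      \<comment> \<open>A single term bounds the sum from below; \<open>undefined\<close> serves as
        an arbitrary action.\<close>
      have "exp (- (B + \<gamma> * M) / \<tau>) \<le> exp (Q v s undefined / \<tau>)" by (rule Q)
      also have "\<dots> \<le> (\<Sum>a\<in>UNIV. exp (Q v s a / \<tau>))" by (rule member_le_sum) auto
      finally have "- (B + \<gamma> * M) / \<tau> \<le> ln (\<Sum>a\<in>UNIV. exp (Q v s a / \<tau>))"
        by (subst ln_ge_iff) (auto intro: sum_pos)
      then have "- (B + \<gamma> * M) \<le> \<tau> * ln (\<Sum>a\<in>UNIV. exp (Q v s a / \<tau>))"
        using \<tau> by (simp add: divide_le_eq mult.commute)
      moreover have "0 \<le> \<tau> * ln (real CARD('a))" using \<tau> card by simp
      ultimately show ?thesis using M by linarith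
    qed
    show "T v \<in> ?S" by (simp add: T_def mem_box_cart up lo)
  qed
  moreover have "0 \<in> ?S" using M0 by (simp add: mem_box_cart)
  ultimately obtain v where "T v = v"
    using brouwer[of ?S T, OF compact_cbox convex_box(1)] by blast
  then have "v $ s = \<tau> * ln (\<Sum>a\<in>UNIV. exp (Q v s a / \<tau>))" for s
    unfolding T_def by (metis vec_lambda_beta)
  then show thesis unfolding Q_def by (rule that)
qed

section \<open>Gradients from Lipschitz subgradients\<close>

text \<open>The subgradient inequality at \<open>x\<close> makes the first-order remainder
  nonnegative. The one at \<open>y\<close> bounds it by
  \<open>(y - x) \<bullet> (u y - u x)\<close>, which the Lipschitz condition makes quadratic in
  \<open>norm (y - x)\<close>.\<close>

lemma GDERIV_of_lipschitz_subgradient: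
  fixes f :: "'v::real_inner \<Rightarrow> real"
  assumes sub: "\<And>x y. f x + (y - x) \<bullet> u x \<le> f y"
    and lip: "\<And>x y. norm (u x - u y) \<le> K * norm (x - y)"
  shows "GDERIV f x :> u x"
  unfolding gderiv_def
proof (rule has_derivativeI_sandwich[where e = 1 and H = "\<lambda>y. K * norm (y - x)"])
  fix y assume "y \<noteq> x"
  have "f y - f x - (y - x) \<bullet> u x \<le> (y - x) \<bullet> (u y - u x)"
    using sub[of y x] by (simp add: algebra_simps inner_diff_left inner_diff_right)
  also have "\<dots> \<le> norm (y - x) * norm (u y - u x)" by (rule norm_cauchy_schwarz)
  also have "\<dots> \<le> norm (y - x) * (K * norm (y - x))" by (intro mult_left_mono lip) simp
  finally have "norm (f y - f x - (y - x) \<bullet> u x) \<le> K * norm (y - x) * norm (y - x)"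
    using sub[of x y] by (simp add: mult_ac)
  then show "norm (f y - f x - (y - x) \<bullet> u x) / norm (y - x) \<le> K * norm (y - x)"
    using \<open>y \<noteq> x\<close> by (simp add: divide_le_eq)
next
  show "((\<lambda>y. K * norm (y - x)) \<longlongrightarrow> 0) (at x)"
    by (rule tendsto_eq_intros refl | simp)+
qed (auto intro: bounded_linear_intros)

lemma gradient_eq:
  assumes "GDERIV f x :> v"
  shows "gradient f x = v"
  unfolding gradient_def
proof (rule the_equality, rule assms)
  fix w assume "GDERIV f x :> w"
  with assms have "(\<lambda>h. h \<bullet> w) = (\<lambda>h. h \<bullet> v)"
    unfolding gderiv_def by (rule has_derivative_unique[rotated])
  then show "w = v" by (simp add: fun_eq_iff vector_eq_ldot)
qed

section \<open>Discounted occupancies: flow equation and returns\<close>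

context
  fixes P :: "'s::finite \<Rightarrow> 'a::finite \<Rightarrow> 's pmf" and \<rho> :: "'s pmf" and \<gamma> :: real
  assumes \<gamma>: "0 \<le> \<gamma>" "\<gamma> < 1"
begin

lemma summable_discounted_prob:
  "summable (\<lambda>t. \<gamma> ^ t * measure (trajectory P \<rho> \<pi>) (A t))"
proof (rule summable_comparison_test')
  interpret prob_space "trajectory P \<rho> \<pi>" by (rule prob_space_trajectory)
  show "summable (\<lambda>t. \<gamma> ^ t)" using \<gamma> by (intro summable_geometric) simp
  show "norm (\<gamma> ^ t * prob (A t)) \<le> \<gamma> ^ t" for t
    using \<gamma> by (simp add: mult_left_le)
qed

lemma occupancy_nonneg: "0 \<le> occupancy P \<gamma> \<rho> \<pi> s"
  unfolding occupancy_def by (intro suminf_nonneg summable_discounted_prob) (use \<gamma> in auto)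

text \<open>The time-0 term gives \<open>\<rho>\<close>; in the remaining series the one-step
  recursion shifts time by one, which releases the factor \<open>\<gamma>\<close>.\<close>

lemma occupancy_flow:
  "occupancy P \<gamma> \<rho> \<pi> s' = pmf \<rho> s' +
     \<gamma> * (\<Sum>s\<in>UNIV. \<Sum>a\<in>UNIV. occupancy P \<gamma> \<rho> \<pi> s * pmf (\<pi> s) a * pmf (P s a) s')"
proof -
  let ?w = "\<lambda>t s. measure (trajectory P \<rho> \<pi>) {\<omega>. fst (\<omega> t) = s}"
  have w0: "?w 0 s' = pmf \<rho> s'"
    by (simp add: measure_trajectory_state_eq_sum measure_trajectory_0 sum_pmf_UNIV flip: sum_distrib_left)
  have wSuc: "?w (Suc t) s' = (\<Sum>s\<in>UNIV. \<Sum>a\<in>UNIV. ?w t s * (pmf (\<pi> s) a * pmf (P s a) s'))" for t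
    by (simp add: measure_trajectory_state_eq_sum[of _ _ _ "Suc t"] measure_trajectory_Suc
      measure_trajectory_state_action[of _ _ _ t] sum_pmf_UNIV mult.assoc flip: sum_distrib_left)
  note sm = summable_discounted_prob[of \<pi> "\<lambda>t. {\<omega>. fst (\<omega> t) = _}"]
  have "occupancy P \<gamma> \<rho> \<pi> s' = ?w 0 s' + (\<Sum>t. \<gamma> ^ Suc t * ?w (Suc t) s')"
    unfolding occupancy_def using suminf_split_head[OF sm[of s']] by simp
  also have "(\<Sum>t. \<gamma> ^ Suc t * ?w (Suc t) s') =
      (\<Sum>t. \<Sum>s\<in>UNIV. \<Sum>a\<in>UNIV. (\<gamma> ^ t * ?w t s) * (\<gamma> * (pmf (\<pi> s) a * pmf (P s a) s')))"
    by (simp add: wSuc sum_distrib_left mult_ac)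
  also have "\<dots> = (\<Sum>s\<in>UNIV. \<Sum>a\<in>UNIV. occupancy P \<gamma> \<rho> \<pi> s * (\<gamma> * (pmf (\<pi> s) a * pmf (P s a) s')))"
    unfolding occupancy_def
    by (simp add: suminf_sum summable_sum summable_mult2 sm suminf_mult2)
  finally show ?thesis by (simp add: w0 sum_distrib_left mult_ac)
qed

text \<open>Summing the flow equation over \<open>s'\<close> shows that the total mass
  \<open>m\<close> satisfies \<open>m = 1 + \<gamma> * m\<close>.\<close>

lemma sum_occupancy: "(\<Sum>s\<in>UNIV. occupancy P \<gamma> \<rho> \<pi> s) = 1 / (1 - \<gamma>)"
proof -
  let ?N = "occupancy P \<gamma> \<rho> \<pi>"
  have "(\<Sum>s\<in>UNIV. ?N s) = 1 + \<gamma> * (\<Sum>s'\<in>UNIV. \<Sum>s\<in>UNIV. \<Sum>a\<in>UNIV. ?N s * pmf (\<pi> s) a * pmf (P s a) s')"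
    by (subst occupancy_flow) (simp add: sum.distrib sum_pmf_UNIV sum_distrib_left)
  also have "(\<Sum>s'\<in>UNIV. \<Sum>s\<in>UNIV. \<Sum>a\<in>UNIV. ?N s * pmf (\<pi> s) a * pmf (P s a) s') =
      (\<Sum>s\<in>UNIV. \<Sum>a\<in>UNIV. \<Sum>s'\<in>UNIV. ?N s * pmf (\<pi> s) a * pmf (P s a) s')"
    by (subst sum.swap, rule sum.cong[OF refl], rule sum.swap)
  also have "\<dots> = (\<Sum>s\<in>UNIV. ?N s)"
    by (simp add: sum_pmf_UNIV flip: sum_distrib_left)
  finally show ?thesis using \<gamma> by (simp add: field_simps)
qed

text \<open>The flow equation paired with a test function \<open>h\<close>. Its point is that the
  right side does not depend on \<open>\<pi>\<close>.\<close>

lemma occupancy_flow_test_function: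
  "(\<Sum>s\<in>UNIV. \<Sum>a\<in>UNIV. occupancy P \<gamma> \<rho> \<pi> s * pmf (\<pi> s) a *
      (h s - \<gamma> * (\<Sum>s'\<in>UNIV. pmf (P s a) s' * h s'))) = (\<Sum>s\<in>UNIV. pmf \<rho> s * h s)"
proof -
  let ?N = "occupancy P \<gamma> \<rho> \<pi>"
  let ?S = "\<Sum>s\<in>UNIV. \<Sum>a\<in>UNIV. ?N s * pmf (\<pi> s) a * (\<Sum>s'\<in>UNIV. pmf (P s a) s' * h s')"
  have "(\<Sum>s'\<in>UNIV. ?N s' * h s') = (\<Sum>s\<in>UNIV. pmf \<rho> s * h s) +
      \<gamma> * (\<Sum>s'\<in>UNIV. \<Sum>s\<in>UNIV. \<Sum>a\<in>UNIV. ?N s * pmf (\<pi> s) a * (pmf (P s a) s' * h s'))"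
    by (subst occupancy_flow)
      (simp add: sum.distrib sum_distrib_left algebra_simps)
  also have "(\<Sum>s'\<in>UNIV. \<Sum>s\<in>UNIV. \<Sum>a\<in>UNIV. ?N s * pmf (\<pi> s) a * (pmf (P s a) s' * h s')) =
      (\<Sum>s\<in>UNIV. \<Sum>a\<in>UNIV. \<Sum>s'\<in>UNIV. ?N s * pmf (\<pi> s) a * (pmf (P s a) s' * h s'))"
    by (subst sum.swap, rule sum.cong[OF refl], rule sum.swap)
  also have "\<dots> = ?S" by (simp add: sum_distrib_left)
  finally have 1: "(\<Sum>s'\<in>UNIV. ?N s' * h s') = (\<Sum>s\<in>UNIV. pmf \<rho> s * h s) + \<gamma> * ?S" .
  have 2: "(\<Sum>s\<in>UNIV. \<Sum>a\<in>UNIV. ?N s * pmf (\<pi> s) a * h s) = (\<Sum>s'\<in>UNIV. ?N s' * h s')"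
    by (simp add: sum_pmf_UNIV flip: sum_distrib_left sum_distrib_right)
  have "(\<Sum>s\<in>UNIV. \<Sum>a\<in>UNIV. ?N s * pmf (\<pi> s) a * (h s - \<gamma> * (\<Sum>s'\<in>UNIV. pmf (P s a) s' * h s'))) =
      (\<Sum>s\<in>UNIV. \<Sum>a\<in>UNIV. ?N s * pmf (\<pi> s) a * h s) - \<gamma> * ?S"
    by (simp add: right_diff_distrib sum_subtractf sum_distrib_left mult_ac)
  with 1 2 show ?thesis by simp
qed

text \<open>The series is dominated by \<open>\<gamma> ^ t * B\<close>, so integral and sum over
  time may be exchanged; each term is then a finite sum over state-action pairs.\<close>

lemma disc_return_eq_occupancy:
  "disc_return P \<gamma> \<rho> f \<pi> =
     (\<Sum>s\<in>UNIV. \<Sum>a\<in>UNIV. occupancy P \<gamma> \<rho> \<pi> s * pmf (\<pi> s) a * f s a)"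
proof -
  let ?M = "trajectory P \<rho> \<pi>"
  interpret prob_space ?M by (rule prob_space_trajectory)
  let ?F = "\<lambda>t \<omega>. \<gamma> ^ t * f (fst (\<omega> t)) (snd (\<omega> t))"
  define B where "B = (\<Sum>s\<in>UNIV. \<Sum>a\<in>UNIV. \<bar>f s a\<bar>)"
  have B: "\<bar>f s a\<bar> \<le> B" for s a
    unfolding B_def by (rule abs_le_sum_sum_abs)
  have bound: "norm (?F t \<omega>) \<le> \<gamma> ^ t * B" for t \<omega>
    using \<gamma> B by (simp add: abs_mult mult_left_mono)
  have meas: "?F t \<in> borel_measurable ?M" for t
    using measurable_compose[OF measurable_trajectory_coordinate,
        of "\<lambda>x. \<gamma> ^ t * f (fst x) (snd x)" borel t P \<rho> \<pi>] by simp
  have int: "integrable ?M (?F t)" for t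
    by (rule integrable_const_bound[OF _ meas]) (use bound in auto)
  have smB: "summable (\<lambda>t. \<gamma> ^ t * B)"
    using \<gamma> by (intro summable_mult2 summable_geometric) simp
  have "disc_return P \<gamma> \<rho> f \<pi> = (\<Sum>t. \<integral>\<omega>. ?F t \<omega> \<partial>?M)"
    unfolding disc_return_def
  proof (rule integral_suminf[OF int])
    show "AE \<omega> in ?M. summable (\<lambda>t. norm (?F t \<omega>))"
      by (rule AE_I2, rule summable_comparison_test'[OF smB]) (use bound in auto)
    show "summable (\<lambda>t. \<integral>\<omega>. norm (?F t \<omega>) \<partial>?M)"
    proof (rule summable_comparison_test'[OF smB])
      show "norm (\<integral>\<omega>. norm (?F t \<omega>) \<partial>?M) \<le> \<gamma> ^ t * B" for t
        using integral_mono[OF integrable_norm[OF int] integrable_const, of t "\<gamma> ^ t * B"] bound[of t]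
        by (simp add: prob_space[simplified])
    qed
  qed
  also have "(\<lambda>t. \<integral>\<omega>. ?F t \<omega> \<partial>?M) = (\<lambda>t. \<Sum>s\<in>UNIV. \<Sum>a\<in>UNIV.
      (\<gamma> ^ t * prob {\<omega>. fst (\<omega> t) = s}) * (pmf (\<pi> s) a * f s a))"
  proof
    fix t
    \<comment> \<open>Coordinate \<open>t\<close> takes finitely many values, so the integrand is a
      combination of indicators.\<close>
    have F: "?F t \<omega> = (\<Sum>s\<in>UNIV. \<Sum>a\<in>UNIV. \<gamma> ^ t * f s a * indicator {\<omega>. \<omega> t = (s, a)} \<omega>)" for \<omega>
    proof -
      have "(\<Sum>x\<in>UNIV. \<gamma> ^ t * f (fst x) (snd x) * indicator {\<omega>. \<omega> t = x} \<omega>) = ?F t \<omega>"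
        by (subst sum.remove[of _ "\<omega> t"]) (auto simp: indicator_def intro!: sum.neutral)
      then show ?thesis
        by (simp only: sum.cartesian_product UNIV_Times_UNIV) (simp only: case_prod_beta' prod.collapse)
    qed
    have int1: "integrable ?M (\<lambda>\<omega>. c * indicator {\<omega>. \<omega> t = x} \<omega>)" for c :: real and x
      by (intro integrable_mult_right integrable_real_indicator sets_trajectory_coordinate)
        (simp add: emeasure_eq_measure)
    from F have "(\<integral>\<omega>. ?F t \<omega> \<partial>?M) = (\<integral>\<omega>. (\<Sum>s\<in>UNIV. \<Sum>a\<in>UNIV. \<gamma> ^ t * f s a * indicator {\<omega>. \<omega> t = (s, a)} \<omega>) \<partial>?M)"
      by (simp only:)
    also have "\<dots> = (\<Sum>s\<in>UNIV. \<Sum>a\<in>UNIV. \<gamma> ^ t * f s a * prob {\<omega>. \<omega> t = (s, a)})"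
      by (simp only: Bochner_Integration.integral_sum Bochner_Integration.integrable_sum int1
          integral_mult_right_zero Bochner_Integration.integral_indicator space_trajectory Int_UNIV_right)
    finally show "(\<integral>\<omega>. ?F t \<omega> \<partial>?M) = (\<Sum>s\<in>UNIV. \<Sum>a\<in>UNIV.
      (\<gamma> ^ t * prob {\<omega>. fst (\<omega> t) = s}) * (pmf (\<pi> s) a * f s a))"
      by (simp only: measure_trajectory_state_action mult_ac)
  qed
  finally have "disc_return P \<gamma> \<rho> f \<pi> = (\<Sum>t. \<Sum>s\<in>UNIV. \<Sum>a\<in>UNIV.
      (\<gamma> ^ t * prob {\<omega>. fst (\<omega> t) = s}) * (pmf (\<pi> s) a * f s a))" .
  also have "\<dots> = (\<Sum>s\<in>UNIV. \<Sum>a\<in>UNIV. occupancy P \<gamma> \<rho> \<pi> s * (pmf (\<pi> s) a * f s a))"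
    by (rule sums_unique[symmetric], intro sums_sum sums_mult2)
      (simp add: occupancy_def summable_sums summable_discounted_prob)
  finally show ?thesis by (simp only: mult.assoc)
qed

section \<open>Entropy-regularised optimality\<close>

text \<open>For the Gibbs policy \<open>\<pi>\<^sub>0\<close> of a Bellman fixed point
  \<open>V\<close>, the reward equals \<open>\<tau> * ln \<pi>\<^sub>0\<close> plus
  \<open>V s\<close> minus the discounted expected next value of \<open>V\<close>. By the flow
  equation the \<open>V\<close> part integrates to the same constant \<open>c\<close> for all
  policies, leaving only KL terms.\<close>

lemma soft_optimal_policy:
  assumes \<tau>: "0 < \<tau>"
  obtains c \<pi>\<^sub>0 where "\<pi>\<^sub>0 \<in> softmax_policies"
    and "\<And>\<pi>. \<pi> \<in> softmax_policies \<Longrightarrow> reg_value P \<gamma> \<rho> R \<tau> \<pi> =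
           c - \<tau> * (\<Sum>s\<in>UNIV. occupancy P \<gamma> \<rho> \<pi> s * pmf_KL (\<pi> s) (\<pi>\<^sub>0 s))"
proof -
  obtain V where V: "\<And>s. V s = \<tau> * ln (\<Sum>a\<in>UNIV. exp ((R s a + \<gamma> * (\<Sum>s'\<in>UNIV. pmf (P s a) s' * V s')) / \<tau>))"
    using soft_bellman_fixed_point[OF \<gamma> \<tau>] by blast
  define Q where "Q s a = R s a + \<gamma> * (\<Sum>s'\<in>UNIV. pmf (P s a) s' * V s')" for s a
  define \<pi>\<^sub>0 where "\<pi>\<^sub>0 s = embed_pmf (\<lambda>a. exp ((Q s a - V s) / \<tau>))" for s
  \<comment> \<open>The exponentiated fixed-point equation says that
    \<open>exp (V s / \<tau>)\<close> is the normaliser of the Gibbs weights.\<close>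
  have sum1: "(\<Sum>a\<in>UNIV. exp ((Q s a - V s) / \<tau>)) = 1" for s
  proof -
    have "exp (V s / \<tau>) = (\<Sum>a\<in>UNIV. exp (Q s a / \<tau>))"
      using \<tau> by (subst V) (simp add: Q_def sum_pos)
    moreover have "(\<Sum>a\<in>UNIV. exp ((Q s a - V s) / \<tau>)) = (\<Sum>a\<in>UNIV. exp (Q s a / \<tau>)) / exp (V s / \<tau>)"
      by (simp add: diff_divide_distrib exp_diff sum_divide_distrib)
    ultimately show ?thesis by (metis divide_self exp_not_eq_zero)
  qed
  have pmf0: "pmf (\<pi>\<^sub>0 s) a = exp ((Q s a - V s) / \<tau>)" for s a
    unfolding \<pi>\<^sub>0_def
    by (rule pmf_embed_pmf) (simp_all add: nn_integral_count_space_finite sum1)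
  show thesis
  proof (rule that)
    show "\<pi>\<^sub>0 \<in> softmax_policies" by (simp add: softmax_policies_iff_pos pmf0)
    fix \<pi> :: "('s, 'a) policy"
    let ?N = "occupancy P \<gamma> \<rho> \<pi>"
    have ent: "disc_entropy P \<gamma> \<rho> \<pi> = disc_return P \<gamma> \<rho> (\<lambda>s a. - ln (pmf (\<pi> s) a)) \<pi>"
      by (simp add: disc_entropy_def disc_return_def)
    have "reg_value P \<gamma> \<rho> R \<tau> \<pi> =
        (\<Sum>s\<in>UNIV. \<Sum>a\<in>UNIV. ?N s * pmf (\<pi> s) a * (R s a - \<tau> * ln (pmf (\<pi> s) a)))"
      unfolding reg_value_def ent disc_return_eq_occupancy
      by (simp add: sum_distrib_left sum.distrib[symmetric] algebra_simps)
    also have "\<dots> = (\<Sum>s\<in>UNIV. \<Sum>a\<in>UNIV.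
        ?N s * pmf (\<pi> s) a * (V s - \<gamma> * (\<Sum>s'\<in>UNIV. pmf (P s a) s' * V s'))
        - \<tau> * (?N s * (pmf (\<pi> s) a * (ln (pmf (\<pi> s) a) - ln (pmf (\<pi>\<^sub>0 s) a)))))"
    proof (intro sum.cong refl)
      fix s a
      have "R s a = \<tau> * ln (pmf (\<pi>\<^sub>0 s) a) + V s - \<gamma> * (\<Sum>s'\<in>UNIV. pmf (P s a) s' * V s')"
        using \<tau> by (simp add: pmf0 Q_def)
      then show "?N s * pmf (\<pi> s) a * (R s a - \<tau> * ln (pmf (\<pi> s) a)) =
        ?N s * pmf (\<pi> s) a * (V s - \<gamma> * (\<Sum>s'\<in>UNIV. pmf (P s a) s' * V s'))
        - \<tau> * (?N s * (pmf (\<pi> s) a * (ln (pmf (\<pi> s) a) - ln (pmf (\<pi>\<^sub>0 s) a))))"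
        by (simp only:) (simp add: algebra_simps)
    qed
    also have "\<dots> = (\<Sum>s\<in>UNIV. pmf \<rho> s * V s) - \<tau> * (\<Sum>s\<in>UNIV. ?N s * pmf_KL (\<pi> s) (\<pi>\<^sub>0 s))"
      unfolding sum_subtractf occupancy_flow_test_function
      by (simp add: pmf_KL_def sum_distrib_left)
    finally show "reg_value P \<gamma> \<rho> R \<tau> \<pi> =
        (\<Sum>s\<in>UNIV. pmf \<rho> s * V s) - \<tau> * (\<Sum>s\<in>UNIV. ?N s * pmf_KL (\<pi> s) (\<pi>\<^sub>0 s))" .
  qed
qed

section \<open>Perturbation of occupancies and returns\<close>

text \<open>With \<open>?D\<close> the L1 distance of the state occupancies, the flow equation gives
  \<open>?D \<le> \<gamma> * ?E\<close>, since \<open>P\<close> does not expand L1 distance, and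
  splitting the products gives \<open>?E \<le> ?\<delta> + ?D\<close>. Solving for \<open>?E\<close>
  yields the factor \<open>1 / (1 - \<gamma>)\<close>.\<close>

lemma state_action_occupancy_L1_diff:
  "(\<Sum>s\<in>UNIV. \<Sum>a\<in>UNIV. \<bar>occupancy P \<gamma> \<rho> \<pi> s * pmf (\<pi> s) a - occupancy P \<gamma> \<rho> \<pi>' s * pmf (\<pi>' s) a\<bar>) \<le>
     (\<Sum>s\<in>UNIV. occupancy P \<gamma> \<rho> \<pi> s * (\<Sum>a\<in>UNIV. \<bar>pmf (\<pi> s) a - pmf (\<pi>' s) a\<bar>)) / (1 - \<gamma>)"
  (is "?E \<le> ?\<delta> / _")
proof -
  let ?N = "occupancy P \<gamma> \<rho> \<pi>" and ?N' = "occupancy P \<gamma> \<rho> \<pi>'"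
  let ?e = "\<lambda>s a. ?N s * pmf (\<pi> s) a - ?N' s * pmf (\<pi>' s) a"
  let ?D = "\<Sum>s\<in>UNIV. \<bar>?N s - ?N' s\<bar>"
  have "?D \<le> (\<Sum>s'\<in>UNIV. \<gamma> * (\<Sum>s\<in>UNIV. \<Sum>a\<in>UNIV. \<bar>?e s a\<bar> * pmf (P s a) s'))"
  proof (rule sum_mono)
    fix s'
    have "?N s' - ?N' s' = \<gamma> * (\<Sum>s\<in>UNIV. \<Sum>a\<in>UNIV. ?e s a * pmf (P s a) s')"
      by (subst (1 2) occupancy_flow) (simp add: left_diff_distrib right_diff_distrib sum_subtractf)
    also have "\<bar>\<dots>\<bar> \<le> \<gamma> * (\<Sum>s\<in>UNIV. \<Sum>a\<in>UNIV. \<bar>?e s a * pmf (P s a) s'\<bar>)"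
      unfolding abs_mult[of \<gamma>] abs_of_nonneg[OF \<gamma>(1)]
      by (intro mult_left_mono order_trans[OF sum_abs] sum_mono sum_abs \<gamma>)
    finally show "\<bar>?N s' - ?N' s'\<bar> \<le> \<gamma> * (\<Sum>s\<in>UNIV. \<Sum>a\<in>UNIV. \<bar>?e s a\<bar> * pmf (P s a) s')"
      by (simp add: abs_mult)
  qed
  also have "\<dots> = \<gamma> * (\<Sum>s\<in>UNIV. \<Sum>a\<in>UNIV. \<Sum>s'\<in>UNIV. \<bar>?e s a\<bar> * pmf (P s a) s')"
    unfolding sum_distrib_left[of \<gamma>, symmetric]
    by (rule arg_cong[where f = "(*) \<gamma>"], subst sum.swap, rule sum.cong[OF refl], rule sum.swap)
  also have "\<dots> = \<gamma> * ?E"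
    by (simp add: sum_pmf_UNIV flip: sum_distrib_left)
  finally have D: "?D \<le> \<gamma> * ?E" .
  have "?E \<le> ?\<delta> + ?D"
  proof -
    have "(\<Sum>a\<in>UNIV. \<bar>?e s a\<bar>) \<le> ?N s * (\<Sum>a\<in>UNIV. \<bar>pmf (\<pi> s) a - pmf (\<pi>' s) a\<bar>) + \<bar>?N s - ?N' s\<bar>" for s
    proof -
      have "(\<Sum>a\<in>UNIV. \<bar>?e s a\<bar>) \<le>
          (\<Sum>a\<in>UNIV. ?N s * \<bar>pmf (\<pi> s) a - pmf (\<pi>' s) a\<bar> + \<bar>?N s - ?N' s\<bar> * pmf (\<pi>' s) a)"
      proof (rule sum_mono)
        fix a
        \<comment> \<open>The splitting weights the policy difference by the occupancy of
          \<open>\<pi>\<close>, the weight that multiplies the KL terms in the optimality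
          gap.\<close>
        have "?e s a = ?N s * (pmf (\<pi> s) a - pmf (\<pi>' s) a) + (?N s - ?N' s) * pmf (\<pi>' s) a"
          by (simp add: algebra_simps)
        then show "\<bar>?e s a\<bar> \<le> ?N s * \<bar>pmf (\<pi> s) a - pmf (\<pi>' s) a\<bar> + \<bar>?N s - ?N' s\<bar> * pmf (\<pi>' s) a"
          using abs_triangle_ineq[of "?N s * (pmf (\<pi> s) a - pmf (\<pi>' s) a)" "(?N s - ?N' s) * pmf (\<pi>' s) a"]
          by (simp add: abs_mult occupancy_nonneg)
      qed
      also have "\<dots> = ?N s * (\<Sum>a\<in>UNIV. \<bar>pmf (\<pi> s) a - pmf (\<pi>' s) a\<bar>) + \<bar>?N s - ?N' s\<bar>"
        by (simp add: sum.distrib sum_pmf_UNIV flip: sum_distrib_left)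
      finally show ?thesis .
    qed
    then show ?thesis
      unfolding sum.distrib[symmetric] by (rule sum_mono)
  qed
  with D \<gamma> show ?thesis by (simp add: field_simps)
qed

text \<open>Of the three powers of \<open>1 - \<gamma>\<close>, two come from squaring the
  perturbation bound and one from the total occupancy mass in Cauchy-Schwarz.\<close>

lemma disc_return_diff_square_le:
  assumes pos: "\<pi> \<in> softmax_policies" "\<pi>' \<in> softmax_policies" and f: "\<And>s a. \<bar>f s a\<bar> \<le> 1"
  shows "(disc_return P \<gamma> \<rho> f \<pi> - disc_return P \<gamma> \<rho> f \<pi>')\<^sup>2 \<le>
    2 * real CARD('a) / (1 - \<gamma>) ^ 3 * (\<Sum>s\<in>UNIV. occupancy P \<gamma> \<rho> \<pi> s * pmf_KL (\<pi> s) (\<pi>' s))"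
proof -
  let ?N = "occupancy P \<gamma> \<rho> \<pi>" and ?N' = "occupancy P \<gamma> \<rho> \<pi>'"
  let ?e = "\<lambda>s a. ?N s * pmf (\<pi> s) a - ?N' s * pmf (\<pi>' s) a"
  define \<delta> where "\<delta> s = (\<Sum>a\<in>UNIV. \<bar>pmf (\<pi> s) a - pmf (\<pi>' s) a\<bar>)" for s
  define KL where "KL = (\<Sum>s\<in>UNIV. ?N s * pmf_KL (\<pi> s) (\<pi>' s))"
  note N = occupancy_nonneg[of \<pi>]
  have "disc_return P \<gamma> \<rho> f \<pi> - disc_return P \<gamma> \<rho> f \<pi>' = (\<Sum>s\<in>UNIV. \<Sum>a\<in>UNIV. ?e s a * f s a)"
    unfolding disc_return_eq_occupancy by (simp add: left_diff_distrib sum_subtractf)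
  also have "\<bar>\<dots>\<bar> \<le> (\<Sum>s\<in>UNIV. \<Sum>a\<in>UNIV. \<bar>?e s a * f s a\<bar>)"
    by (intro order_trans[OF sum_abs] sum_mono sum_abs)
  also have "\<dots> \<le> (\<Sum>s\<in>UNIV. \<Sum>a\<in>UNIV. \<bar>?e s a\<bar>)"
    by (intro sum_mono) (simp add: abs_mult f mult_left_le)
  also have "\<dots> \<le> (\<Sum>s\<in>UNIV. ?N s * \<delta> s) / (1 - \<gamma>)"
    unfolding \<delta>_def by (rule state_action_occupancy_L1_diff)
  finally have "(disc_return P \<gamma> \<rho> f \<pi> - disc_return P \<gamma> \<rho> f \<pi>')\<^sup>2 \<le> ((\<Sum>s\<in>UNIV. ?N s * \<delta> s) / (1 - \<gamma>))\<^sup>2"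
    by (rule abs_le_square_iff[THEN iffD1, OF order_trans[OF _ abs_ge_self]])
  \<comment> \<open>Splitting the weight into two square roots prepares Cauchy-Schwarz.\<close>
  also have "\<dots> = (\<Sum>s\<in>UNIV. sqrt (?N s) * (sqrt (?N s) * \<delta> s))\<^sup>2 / (1 - \<gamma>)\<^sup>2"
    by (simp add: power_divide N flip: mult.assoc)
  also have "\<dots> \<le> ((\<Sum>s\<in>UNIV. (sqrt (?N s))\<^sup>2) * (\<Sum>s\<in>UNIV. (sqrt (?N s) * \<delta> s)\<^sup>2)) / (1 - \<gamma>)\<^sup>2"
    by (intro divide_right_mono Cauchy_Schwarz_ineq_sum) simp
  also have "\<dots> = (\<Sum>s\<in>UNIV. ?N s * (\<delta> s)\<^sup>2) / (1 - \<gamma>) ^ 3"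
  proof -
    have "(1 - \<gamma>) ^ 3 = (1 - \<gamma>) * (1 - \<gamma>)\<^sup>2" by (simp add: power3_eq_cube power2_eq_square)
    then show ?thesis by (simp add: N power_mult_distrib sum_occupancy)
  qed
  also have "\<dots> \<le> (\<Sum>s\<in>UNIV. ?N s * (2 * real CARD('a) * pmf_KL (\<pi> s) (\<pi>' s))) / (1 - \<gamma>) ^ 3"
    using \<gamma> pos unfolding \<delta>_def
    by (intro divide_right_mono sum_mono mult_left_mono L1_square_le_KL N) (auto simp: softmax_policies_iff_pos)
  also have "\<dots> = 2 * real CARD('a) / (1 - \<gamma>) ^ 3 * KL"
    by (simp add: KL_def sum_distrib_left mult_ac)
  finally show ?thesis unfolding KL_def .
qed

lemma utility_vec_diff_square_le:
  fixes g :: "'s \<Rightarrow> 'a \<Rightarrow> real ^ 'n::finite"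
  assumes "\<pi> \<in> softmax_policies" "\<pi>' \<in> softmax_policies" and g: "\<And>s a i. \<bar>g s a $ i\<bar> \<le> 1"
  shows "(norm (utility_vec P \<gamma> \<rho> g \<pi> - utility_vec P \<gamma> \<rho> g \<pi>'))\<^sup>2 \<le>
    2 * real CARD('n) * real CARD('a) / (1 - \<gamma>) ^ 3 *
      (\<Sum>s\<in>UNIV. occupancy P \<gamma> \<rho> \<pi> s * pmf_KL (\<pi> s) (\<pi>' s))"
proof -
  let ?B = "2 * real CARD('a) / (1 - \<gamma>) ^ 3 *
    (\<Sum>s\<in>UNIV. occupancy P \<gamma> \<rho> \<pi> s * pmf_KL (\<pi> s) (\<pi>' s))"
  have "(norm (utility_vec P \<gamma> \<rho> g \<pi> - utility_vec P \<gamma> \<rho> g \<pi>'))\<^sup>2 =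
      (\<Sum>i\<in>UNIV. (disc_return P \<gamma> \<rho> (\<lambda>s a. g s a $ i) \<pi> - disc_return P \<gamma> \<rho> (\<lambda>s a. g s a $ i) \<pi>')\<^sup>2)"
    unfolding power2_norm_eq_inner inner_vec_def by (simp add: utility_vec_def power2_eq_square)
  also have "\<dots> \<le> (\<Sum>i\<in>(UNIV :: 'n set). ?B)"
    by (intro sum_mono disc_return_diff_square_le assms)
  finally show ?thesis by (simp add: mult_ac)
qed

section \<open>The Lagrangian and the dual function\<close>

text \<open>Returns are linear in the reward, so the multiplier can be absorbed into the reward; the
  unconstrained soft optimality result then applies to the Lagrangian.\<close>

lemma lagrangian_eq_reg_value:
  "lagrangian P \<gamma> \<rho> r g b \<tau> l \<pi> = reg_value P \<gamma> \<rho> (\<lambda>s a. r s a + l \<bullet> g s a) \<tau> \<pi> - l \<bullet> b"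
proof -
  have "utility_vec P \<gamma> \<rho> g \<pi> =
      (\<Sum>s\<in>UNIV. \<Sum>a\<in>UNIV. (occupancy P \<gamma> \<rho> \<pi> s * pmf (\<pi> s) a) *\<^sub>R g s a)"
    by (simp add: vec_eq_iff utility_vec_def disc_return_eq_occupancy)
  then have "l \<bullet> utility_vec P \<gamma> \<rho> g \<pi> = disc_return P \<gamma> \<rho> (\<lambda>s a. l \<bullet> g s a) \<pi>"
    by (simp add: inner_sum_right disc_return_eq_occupancy)
  moreover have "disc_return P \<gamma> \<rho> (\<lambda>s a. r s a + l \<bullet> g s a) \<pi> =
      disc_return P \<gamma> \<rho> r \<pi> + disc_return P \<gamma> \<rho> (\<lambda>s a. l \<bullet> g s a) \<pi>"
    by (simp add: disc_return_eq_occupancy sum.distrib distrib_left)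
  ultimately show ?thesis
    by (simp add: lagrangian_def reg_value_def inner_diff_right)
qed

lemma lagrangian_affine:
  "lagrangian P \<gamma> \<rho> r g b \<tau> l' \<pi> =
     lagrangian P \<gamma> \<rho> r g b \<tau> l \<pi> + (l' - l) \<bullet> (utility_vec P \<gamma> \<rho> g \<pi> - b)"
  by (simp add: lagrangian_def inner_diff_left)

lemma dual_fun_eq_lagrangian_maximizer:
  assumes "lagrangian_maximizer P \<gamma> \<rho> r g b \<tau> l \<pi>"
  shows "dual_fun P \<gamma> \<rho> r g b \<tau> l = lagrangian P \<gamma> \<rho> r g b \<tau> l \<pi>"
  unfolding dual_fun_def
  by (rule cSup_eq_maximum)
    (use assms in \<open>auto simp: lagrangian_maximizer_def is_arg_max_linorder\<close>)

text \<open>The divergence of \<open>\<pi>\<^sub>0\<close> from itself vanishes, so the constant of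
  the value formula is the value of \<open>\<pi>\<^sub>0\<close>. Nonnegativity of KL makes it a
  maximiser.\<close>

lemma lagrangian_optimality_gap:
  assumes \<tau>: "0 < \<tau>"
  obtains \<pi>\<^sub>0 where "lagrangian_maximizer P \<gamma> \<rho> r g b \<tau> l \<pi>\<^sub>0"
    and "\<And>\<pi>. \<pi> \<in> softmax_policies \<Longrightarrow> lagrangian P \<gamma> \<rho> r g b \<tau> l \<pi>\<^sub>0 - lagrangian P \<gamma> \<rho> r g b \<tau> l \<pi> =
           \<tau> * (\<Sum>s\<in>UNIV. occupancy P \<gamma> \<rho> \<pi> s * pmf_KL (\<pi> s) (\<pi>\<^sub>0 s))"
proof -
  obtain c \<pi>\<^sub>0 where soft: "\<pi>\<^sub>0 \<in> softmax_policies"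
    and val: "\<And>\<pi>. \<pi> \<in> softmax_policies \<Longrightarrow> reg_value P \<gamma> \<rho> (\<lambda>s a. r s a + l \<bullet> g s a) \<tau> \<pi> =
           c - \<tau> * (\<Sum>s\<in>UNIV. occupancy P \<gamma> \<rho> \<pi> s * pmf_KL (\<pi> s) (\<pi>\<^sub>0 s))"
    by (rule soft_optimal_policy[OF \<tau>, of "\<lambda>s a. r s a + l \<bullet> g s a"]) (rule that; assumption)
  have gap: "lagrangian P \<gamma> \<rho> r g b \<tau> l \<pi>\<^sub>0 - lagrangian P \<gamma> \<rho> r g b \<tau> l \<pi> =
           \<tau> * (\<Sum>s\<in>UNIV. occupancy P \<gamma> \<rho> \<pi> s * pmf_KL (\<pi> s) (\<pi>\<^sub>0 s))" if "\<pi> \<in> softmax_policies" for \<pi>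
    unfolding lagrangian_eq_reg_value val[OF that] val[OF soft] by (simp add: pmf_KL_def)
  moreover have "0 \<le> \<tau> * (\<Sum>s\<in>UNIV. occupancy P \<gamma> \<rho> \<pi> s * pmf_KL (\<pi> s) (\<pi>\<^sub>0 s))"
    if "\<pi> \<in> softmax_policies" for \<pi>
    using \<tau> soft that
    by (intro mult_nonneg_nonneg sum_nonneg occupancy_nonneg pmf_KL_nonneg)
      (auto simp: softmax_policies_iff_pos)
  ultimately have "lagrangian_maximizer P \<gamma> \<rho> r g b \<tau> l \<pi>\<^sub>0"
    using soft by (fastforce simp: lagrangian_maximizer_def is_arg_max_linorder)
  then show thesis using gap by (rule that)
qed

text \<open>A single function \<open>u\<close> carries all claims: maximisers at \<open>l\<close>
  are only shown to share their utility vector, and that already makes the choice of maximiser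
  harmless.\<close>

theorem dual_fun_gradient:
  fixes g :: "'s \<Rightarrow> 'a \<Rightarrow> real ^ 'n::finite"
  assumes \<tau>: "0 < \<tau>" and g: "\<And>s a i. \<bar>g s a $ i\<bar> \<le> 1"
  defines "K \<equiv> real CARD('n) * real CARD('a) / (\<tau> * (1 - \<gamma>) ^ 3)"
  obtains u where
    "\<And>l. \<exists>\<pi>. lagrangian_maximizer P \<gamma> \<rho> r g b \<tau> l \<pi>"
    and "\<And>l \<pi>. lagrangian_maximizer P \<gamma> \<rho> r g b \<tau> l \<pi> \<Longrightarrow> utility_vec P \<gamma> \<rho> g \<pi> - b = u l"
    and "\<And>l. GDERIV (dual_fun P \<gamma> \<rho> r g b \<tau>) l :> u l"
    and "\<And>l l'. norm (u l - u l') \<le> K * norm (l - l')"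
proof -
  let ?L = "lagrangian P \<gamma> \<rho> r g b \<tau>" and ?max = "lagrangian_maximizer P \<gamma> \<rho> r g b \<tau>"
  let ?U = "utility_vec P \<gamma> \<rho> g"
  let ?X = "\<lambda>\<pi> \<pi>'. \<Sum>s\<in>UNIV. occupancy P \<gamma> \<rho> \<pi> s * pmf_KL (\<pi> s) (\<pi>' s)"
  define C where "C = 2 * real CARD('n) * real CARD('a) / (1 - \<gamma>) ^ 3"
  have K: "K = C / (2 * \<tau>)" by (simp add: K_def C_def)
  have K0: "0 \<le> K" using \<gamma> \<tau> by (simp add: K_def)
  have "\<exists>\<pi>. ?max l \<pi> \<and> (\<forall>\<pi>'\<in>softmax_policies. ?L l \<pi> - ?L l \<pi>' = \<tau> * ?X \<pi>' \<pi>)" for l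
    by (rule lagrangian_optimality_gap[OF \<tau>, of r g b l]) blast
  then have "\<exists>p. \<forall>l. ?max l (p l) \<and> (\<forall>\<pi>'\<in>softmax_policies. ?L l (p l) - ?L l \<pi>' = \<tau> * ?X \<pi>' (p l))"
    by (intro choice allI)
  then obtain p where max: "\<And>l. ?max l (p l)"
    and gap: "\<And>l \<pi>. \<pi> \<in> softmax_policies \<Longrightarrow> ?L l (p l) - ?L l \<pi> = \<tau> * ?X \<pi> (p l)"
    by blast
  define u where "u l = ?U (p l) - b" for l
  have soft: "p l \<in> softmax_policies" for l
    using max[of l] by (simp add: lagrangian_maximizer_def is_arg_max_linorder)
  have U: "(norm (?U \<pi> - ?U \<pi>'))\<^sup>2 \<le> C * ?X \<pi> \<pi>'"
    if "\<pi> \<in> softmax_policies" "\<pi>' \<in> softmax_policies" for \<pi> \<pi>'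
    unfolding C_def by (rule utility_vec_diff_square_le[OF that g])
  \<comment> \<open>A second maximiser has gap zero, hence zero weighted KL from \<open>p l\<close>,
    and the quadratic bound forces equal utilities.\<close>
  have uniq: "?U \<pi> - b = u l" if "?max l \<pi>" for l \<pi>
  proof -
    have \<pi>: "\<pi> \<in> softmax_policies" and "?L l (p l) \<le> ?L l \<pi>"
      using that soft[of l] by (simp_all add: lagrangian_maximizer_def is_arg_max_linorder)
    then have "\<tau> * ?X \<pi> (p l) \<le> 0" using gap[of \<pi> l] by simp
    then have "?X \<pi> (p l) \<le> 0" using \<tau> by (simp add: mult_le_0_iff)
    moreover have "0 \<le> C" using \<gamma> by (simp add: C_def)
    ultimately have "(norm (?U \<pi> - ?U (p l)))\<^sup>2 \<le> 0"
      using U[OF \<pi> soft[of l]] by (meson mult_nonneg_nonpos order_trans)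
    then show ?thesis by (simp add: u_def)
  qed
  have lip: "norm (u l - u l') \<le> K * norm (l - l')" for l l'
  proof -
    \<comment> \<open>Adding the gap of \<open>p l'\<close> at \<open>l\<close> to the gap of
      \<open>p l\<close> at \<open>l'\<close> cancels the regularised values, leaving the part
      linear in the multipliers.\<close>
    have inner: "\<tau> * (?X (p l') (p l) + ?X (p l) (p l')) = (l - l') \<bullet> (u l - u l')"
      using gap[OF soft, of l l'] gap[OF soft, of l' l] lagrangian_affine[of r g b \<tau> l' "p l" l]
        lagrangian_affine[of r g b \<tau> l' "p l'" l]
      by (simp add: u_def algebra_simps inner_diff_left inner_diff_right)
    \<comment> \<open>Using the quadratic bound in both directions gains the factor 2 that appears
      in \<open>K = C / (2 * \<tau>)\<close>.\<close>
    have "2 * (norm (u l - u l'))\<^sup>2 \<le> C * (?X (p l') (p l) + ?X (p l) (p l'))"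
      using U[OF soft[of l] soft[of l']] U[OF soft[of l'] soft[of l]]
      by (simp add: u_def norm_minus_commute distrib_left)
    also have "C * (?X (p l') (p l) + ?X (p l) (p l')) = 2 * (K * ((l - l') \<bullet> (u l - u l')))"
      unfolding inner[symmetric] using \<tau> by (simp add: K)
    finally have "(norm (u l - u l'))\<^sup>2 \<le> K * ((l - l') \<bullet> (u l - u l'))" by simp
    also have "\<dots> \<le> K * (norm (l - l') * norm (u l - u l'))"
      by (intro mult_left_mono norm_cauchy_schwarz K0)
    finally have "norm (u l - u l') * norm (u l - u l') \<le> (K * norm (l - l')) * norm (u l - u l')"
      by (simp add: power2_eq_square mult_ac)
    then show ?thesis
      using K0 by (cases "u l = u l'") (auto simp: mult_le_cancel_right)
  qed
  have "GDERIV (dual_fun P \<gamma> \<rho> r g b \<tau>) l :> u l" for l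
  proof (rule GDERIV_of_lipschitz_subgradient[OF _ lip])
    fix l l'
    \<comment> \<open>The policy \<open>p l\<close> competes at \<open>l'\<close>, and its
      Lagrangian is affine in the multiplier with slope \<open>u l\<close>: this is the subgradient
      inequality.\<close>
    have "?L l' (p l) \<le> ?L l' (p l')"
      using max[of l'] soft[of l] by (simp add: lagrangian_maximizer_def is_arg_max_linorder)
    then show "dual_fun P \<gamma> \<rho> r g b \<tau> l + (l' - l) \<bullet> u l \<le> dual_fun P \<gamma> \<rho> r g b \<tau> l'"
      unfolding dual_fun_eq_lagrangian_maximizer[OF max] u_def
      by (simp add: lagrangian_affine[of r g b \<tau> l' "p l" l])
  qed
  with max uniq lip show thesis by (intro that) blast+
qed

section \<open>Comparison with the stated constant\<close>

text \<open>Visitation frequencies sum to 1, so the mass of one arbitrary state, here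
  \<open>undefined\<close>, is at most 1.\<close>

lemma visitation_lower_bound_le_1:
  assumes "\<And>s. d \<le> visitation P \<gamma> \<rho> \<pi> s" "0 \<le> d"
  shows "d \<le> 1"
proof -
  have "d \<le> visitation P \<gamma> \<rho> \<pi> undefined" by (rule assms)
  also have "\<dots> \<le> (\<Sum>s\<in>UNIV. visitation P \<gamma> \<rho> \<pi> s)"
    by (rule member_le_sum) (auto intro: order_trans[OF assms(2,1)])
  also have "\<dots> = 1"
    using \<gamma> by (simp add: visitation_eq_occupancy sum_occupancy flip: sum_distrib_left)
  finally show ?thesis .
qed

end

theorem proposition3p6:
  fixes P :: "'s::finite \<Rightarrow> 'a::finite \<Rightarrow> 's pmf"
    and \<rho> :: "'s pmf"
    and r :: "'s \<Rightarrow> 'a \<Rightarrow> real"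
    and g :: "'s \<Rightarrow> 'a \<Rightarrow> real ^ 'n::finite"
    and b \<xi> :: "real ^ 'n"
    and \<gamma> \<tau> d :: real
    and \<pi>_opt \<pi>_bar :: "('s, 'a) policy"
  assumes "0 \<le> \<gamma>" and "\<gamma> < 1"
    and "\<And>s a. 0 \<le> r s a \<and> r s a \<le> 1"
    and "\<And>s a i. 0 \<le> g s a $ i \<and> g s a $ i \<le> 1"
    and "\<And>i. 0 \<le> b $ i \<and> b $ i \<le> 1 / (1 - \<gamma>)"
    and "\<tau> > 0"
    and "d > 0"
    and "\<And>\<pi> s. \<pi> \<in> softmax_policies \<Longrightarrow> visitation P \<gamma> \<rho> \<pi> s \<ge> d"
    and "is_arg_max (reg_value P \<gamma> \<rho> r \<tau>) (primal_feasible P \<gamma> \<rho> g b) \<pi>_opt"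
    and "\<pi>_bar \<in> softmax_policies"
    and "\<And>i. \<xi> $ i > 0"
    and "\<And>i. utility_vec P \<gamma> \<rho> g \<pi>_bar $ i - b $ i \<ge> \<xi> $ i"
  defines "D \<equiv> dual_fun P \<gamma> \<rho> r g b \<tau>"
    and "\<Lambda> \<equiv> {l :: real ^ 'n. \<forall>i. 0 \<le> l $ i \<and>
            l $ i \<le> (reg_value P \<gamma> \<rho> r \<tau> \<pi>_opt - reg_value P \<gamma> \<rho> r \<tau> \<pi>_bar) / \<xi> $ i}"
    and "L \<equiv> 2 * ln 2 * (real CARD('n) * real CARD('a) + (1 - \<gamma>)\<^sup>2 * sqrt (real CARD('n) * real CARD('a)))
            / (\<tau> * (1 - \<gamma>) ^ 3 * d)"
  shows "(\<forall>l. (\<exists>\<pi>. lagrangian_maximizer P \<gamma> \<rho> r g b \<tau> l \<pi>) \<and>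
             D differentiable (at l) \<and>
             (\<forall>\<pi>. lagrangian_maximizer P \<gamma> \<rho> r g b \<tau> l \<pi> \<longrightarrow>
                  GDERIV D l :> (utility_vec P \<gamma> \<rho> g \<pi> - b)))
       \<and> (\<forall>l1\<in>\<Lambda>. \<forall>l2\<in>\<Lambda>. norm (gradient D l1 - gradient D l2) \<le> L * norm (l1 - l2))"
proof -
  let ?K = "real CARD('n) * real CARD('a) / (\<tau> * (1 - \<gamma>) ^ 3)"
  note \<gamma> = \<open>0 \<le> \<gamma>\<close> \<open>\<gamma> < 1\<close>
  have g: "\<bar>g s a $ i\<bar> \<le> 1" for s a i using assms(4)[of s a i] by simp
  obtain u where ex: "\<And>l. \<exists>\<pi>. lagrangian_maximizer P \<gamma> \<rho> r g b \<tau> l \<pi>"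
    and uniq: "\<And>l \<pi>. lagrangian_maximizer P \<gamma> \<rho> r g b \<tau> l \<pi> \<Longrightarrow> utility_vec P \<gamma> \<rho> g \<pi> - b = u l"
    and deriv: "\<And>l. GDERIV D l :> u l"
    and lip: "\<And>l l'. norm (u l - u l') \<le> ?K * norm (l - l')"
    by (rule dual_fun_gradient[where P = P and \<rho> = \<rho> and r = r and g = g and b = b,
          OF \<gamma> \<open>\<tau> > 0\<close> g, folded D_def])
      (rule that; assumption)
  have "d \<le> 1"
    using visitation_lower_bound_le_1[OF \<gamma>] assms(8)[OF \<open>\<pi>_bar \<in> softmax_policies\<close>] \<open>d > 0\<close>
    by (meson less_imp_le)
  \<comment> \<open>From \<open>ln x \<le> x - 1\<close> at \<open>x = 1 / 2\<close>; thus
    \<open>2 * ln 2\<close> is at least 1.\<close>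
  have "1 / 2 \<le> ln (2 :: real)"
    using ln_le_minus_one[of "1 / 2 :: real"] by (simp add: ln_div)
  then have "1 * (real CARD('n) * real CARD('a)) \<le> 2 * ln 2 *
      (real CARD('n) * real CARD('a) + (1 - \<gamma>)\<^sup>2 * sqrt (real CARD('n) * real CARD('a)))"
    by (intro mult_mono) simp_all
  \<comment> \<open>The numerator grows by the factor \<open>2 * ln 2\<close> and a nonnegative
    square-root term, while \<open>d \<le> 1\<close> shrinks the denominator.\<close>
  then have "?K \<le> L"
    unfolding L_def using \<gamma> \<open>\<tau> > 0\<close> \<open>d > 0\<close> \<open>d \<le> 1\<close>
    by (intro frac_le) (simp_all add: mult_left_le)
  then have "norm (u l - u l') \<le> L * norm (l - l')" for l l'
    by (rule order_trans[OF lip mult_right_mono]) simp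
  moreover have "gradient D l = u l" for l by (rule gradient_eq[OF deriv])
  moreover have "D differentiable (at l)" for l
    using deriv[of l] by (auto simp: gderiv_def differentiable_def)
  ultimately show ?thesis using ex uniq deriv by simp
qed

end
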